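(* Let $(M,\tau)$ be a tracial von Neumann algebra and let $y=y^*\in M$ be algebraic. Assume that the spectral measure of $y$ has no atoms. Then $\chi(y)>-\infty$.
   Context: A tracial von Neumann algebra $(M,\tau)$ is a von Neumann algebra $M$ with a faithful normal tracial state $\tau$. The spectral measure of a self-adjoint $y\in M$ is the compactly supported probability measure $\mu$ on $\mathbb{R}$ with $\int t^k\,d\mu(t)=\tau(y^k)$ for all $k\ge0$. The element $y$ is called algebraic if the Cauchy transform $G_\mu(z)=\int\frac{d\mu(t)}{z-t}$ of its spectral measure is algebraic, i.e. there is a nonzero polynomial $Q\in\mathbb{C}[z,w]$ with $Q(z,G_\mu(z))=0$ for all $z$ in the open upper half-plane. For a single self-adjoint variable $y$ with spectral measure $\mu$, the free entropy is $\chi(y)=\iint\log|s-t|\,d\mu(s)\,d\mu(t)+C\in[-\infty,\infty)$, where $C=\frac34+\frac12\log 2\pi$ is a universal constant. *)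

theory Defs
  imports "HOL-Probability.Probability" "HOL-Computational_Algebra.Polynomial"
begin

section \<open>Complex Hilbert spaces\<close>

text \<open>
  The complex inner product is linear in the second argument and conjugate-linear in the first.
  Norm and topology are those of the underlying real Hilbert space, whose inner product is the
  real part of the complex one.  Positive definiteness is inherited from \<^class>\<open>real_inner\<close>.
\<close>

class complex_hilbert_space = real_inner + complete_space +
  fixes scaleC :: "complex \<Rightarrow> 'a \<Rightarrow> 'a" (infixr "*\<^sub>C" 75)
    and cinner :: "'a \<Rightarrow> 'a \<Rightarrow> complex"
  assumes scaleC_of_real: "of_real r *\<^sub>C x = r *\<^sub>R x"
    and scaleC_add_right: "c *\<^sub>C (x + y) = c *\<^sub>C x + c *\<^sub>C y"
    and scaleC_add_left: "(c + d) *\<^sub>C x = c *\<^sub>C x + d *\<^sub>C x"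
    and scaleC_scaleC: "c *\<^sub>C d *\<^sub>C x = (c * d) *\<^sub>C x"
    and cinner_commute: "cinner x y = cnj (cinner y x)"
    and cinner_add_right: "cinner x (y + z) = cinner x y + cinner x z"
    and cinner_scaleC_right: "cinner x (c *\<^sub>C y) = c * cinner x y"
    and inner_eq_Re_cinner: "inner x y = Re (cinner x y)"

lemma norm_scaleC:
  fixes x :: "'a::complex_hilbert_space"
  shows "norm (c *\<^sub>C x) = cmod c * norm x"
proof -
  have "cinner (c *\<^sub>C x) (c *\<^sub>C x) = c * (cnj c * cnj (cinner x x))"
    by (metis cinner_commute cinner_scaleC_right complex_cnj_mult)
  also have "\<dots> = of_real ((cmod c)\<^sup>2) * cnj (cinner x x)"
    by (simp only: mult.assoc[symmetric] complex_norm_square)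
  finally have "inner (c *\<^sub>C x) (c *\<^sub>C x) = (cmod c)\<^sup>2 * inner x x"
    by (simp add: inner_eq_Re_cinner)
  then show ?thesis
    by (simp add: norm_eq_sqrt_inner real_sqrt_mult)
qed

lemma bounded_linear_scaleC: "bounded_linear (\<lambda>x::'a::complex_hilbert_space. c *\<^sub>C x)"
proof (rule bounded_linear_intro[where K = "cmod c"])
  fix r :: real and x y :: 'a
  show "c *\<^sub>C (x + y) = c *\<^sub>C x + c *\<^sub>C y"
    by (rule scaleC_add_right)
  show "c *\<^sub>C (r *\<^sub>R x) = r *\<^sub>R (c *\<^sub>C x)"
    by (simp add: scaleC_of_real[symmetric] scaleC_scaleC mult.commute)
  show "norm (c *\<^sub>C x) \<le> norm x * cmod c"
    by (simp add: norm_scaleC mult.commute)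
qed


section \<open>Bounded operators\<close>

text \<open>
  The type \<open>'h \<Rightarrow>\<^sub>L 'h\<close> consists of the bounded real-linear operators; \<open>B(H)\<close> is the subset of
  the complex-linear ones.
\<close>

definition complex_linear :: "('h::complex_hilbert_space \<Rightarrow>\<^sub>L 'h) \<Rightarrow> bool" where
  "complex_linear T \<longleftrightarrow> (\<forall>c x. T (c *\<^sub>C x) = c *\<^sub>C T x)"

lift_definition scaleC_op ::
  "complex \<Rightarrow> ('h::complex_hilbert_space \<Rightarrow>\<^sub>L 'h) \<Rightarrow> 'h \<Rightarrow>\<^sub>L 'h"
  is "\<lambda>c T x. c *\<^sub>C T x"
  by (rule bounded_linear_compose[OF bounded_linear_scaleC])

primrec op_power :: "('h::complex_hilbert_space \<Rightarrow>\<^sub>L 'h) \<Rightarrow> nat \<Rightarrow> 'h \<Rightarrow>\<^sub>L 'h" where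
  "op_power T 0 = id_blinfun"
| "op_power T (Suc k) = T o\<^sub>L op_power T k"

definition is_adjoint ::
  "('h::complex_hilbert_space \<Rightarrow>\<^sub>L 'h) \<Rightarrow> ('h \<Rightarrow>\<^sub>L 'h) \<Rightarrow> bool" where
  "is_adjoint T S \<longleftrightarrow> (\<forall>x y. cinner (S x) y = cinner x (T y))"

definition self_adjoint :: "('h::complex_hilbert_space \<Rightarrow>\<^sub>L 'h) \<Rightarrow> bool" where
  "self_adjoint T \<longleftrightarrow> is_adjoint T T"

definition positive_op :: "('h::complex_hilbert_space \<Rightarrow>\<^sub>L 'h) \<Rightarrow> bool" where
  "positive_op T \<longleftrightarrow> (\<forall>x. cinner x (T x) \<in> \<real>\<^sub>\<ge>\<^sub>0)"

definition op_le :: "('h::complex_hilbert_space \<Rightarrow>\<^sub>L 'h) \<Rightarrow> ('h \<Rightarrow>\<^sub>L 'h) \<Rightarrow> bool" where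
  "op_le S T \<longleftrightarrow> positive_op (T - S)"


section \<open>Tracial von Neumann algebras\<close>

locale von_neumann_algebra =
  fixes M :: "('h::complex_hilbert_space \<Rightarrow>\<^sub>L 'h) set"
  assumes complex_linear: "T \<in> M \<Longrightarrow> complex_linear T"
    and id_mem: "id_blinfun \<in> M"
    and add_mem: "S \<in> M \<Longrightarrow> T \<in> M \<Longrightarrow> S + T \<in> M"
    and scaleC_mem: "T \<in> M \<Longrightarrow> scaleC_op c T \<in> M"
    and compose_mem: "S \<in> M \<Longrightarrow> T \<in> M \<Longrightarrow> S o\<^sub>L T \<in> M"
    and adjoint_mem: "T \<in> M \<Longrightarrow> \<exists>S\<in>M. is_adjoint T S"
    and closed: "closedin strong_operator_topology M"

definition is_sup_in ::
  "('h::complex_hilbert_space \<Rightarrow>\<^sub>L 'h) set \<Rightarrow> ('h \<Rightarrow>\<^sub>L 'h) set \<Rightarrow> ('h \<Rightarrow>\<^sub>L 'h) \<Rightarrow> bool" where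
  "is_sup_in M D s \<longleftrightarrow> s \<in> M \<and> self_adjoint s \<and> (\<forall>T\<in>D. op_le T s) \<and>
     (\<forall>u\<in>M. self_adjoint u \<and> (\<forall>T\<in>D. op_le T u) \<longrightarrow> op_le s u)"

text \<open>
  Normality is preservation of suprema of bounded increasing nets of self-adjoint elements,
  phrased with upward directed sets in place of nets.
\<close>

locale tracial_von_neumann_algebra = von_neumann_algebra M
  for M :: "('h::complex_hilbert_space \<Rightarrow>\<^sub>L 'h) set" +
  fixes \<tau> :: "('h \<Rightarrow>\<^sub>L 'h) \<Rightarrow> complex"
  assumes trace_add: "S \<in> M \<Longrightarrow> T \<in> M \<Longrightarrow> \<tau> (S + T) = \<tau> S + \<tau> T"
    and trace_scaleC: "T \<in> M \<Longrightarrow> \<tau> (scaleC_op c T) = c * \<tau> T"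
    and trace_positive: "T \<in> M \<Longrightarrow> positive_op T \<Longrightarrow> \<tau> T \<in> \<real>\<^sub>\<ge>\<^sub>0"
    and trace_id: "\<tau> id_blinfun = 1"
    and trace_commute: "S \<in> M \<Longrightarrow> T \<in> M \<Longrightarrow> \<tau> (S o\<^sub>L T) = \<tau> (T o\<^sub>L S)"
    and trace_faithful: "T \<in> M \<Longrightarrow> positive_op T \<Longrightarrow> \<tau> T = 0 \<Longrightarrow> T = 0"
    and trace_normal:
      "D \<subseteq> M \<Longrightarrow> D \<noteq> {} \<Longrightarrow> (\<And>T. T \<in> D \<Longrightarrow> self_adjoint T) \<Longrightarrow>
       (\<And>S T. S \<in> D \<Longrightarrow> T \<in> D \<Longrightarrow> \<exists>U\<in>D. op_le S U \<and> op_le T U) \<Longrightarrow>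
       is_sup_in M D s \<Longrightarrow> Re (\<tau> s) = (SUP T\<in>D. Re (\<tau> T))"


section \<open>Spectral measure, algebraicity and free entropy\<close>

definition is_spectral_measure ::
  "(('h::complex_hilbert_space \<Rightarrow>\<^sub>L 'h) \<Rightarrow> complex) \<Rightarrow> ('h \<Rightarrow>\<^sub>L 'h) \<Rightarrow> real measure \<Rightarrow> bool" where
  "is_spectral_measure \<tau> y \<mu> \<longleftrightarrow>
     real_distribution \<mu> \<and> (\<exists>K. compact K \<and> emeasure \<mu> (- K) = 0) \<and>
     (\<forall>k. of_real (LINT t|\<mu>. t ^ k) = \<tau> (op_power y k))"

definition spectral_measure ::
  "(('h::complex_hilbert_space \<Rightarrow>\<^sub>L 'h) \<Rightarrow> complex) \<Rightarrow> ('h \<Rightarrow>\<^sub>L 'h) \<Rightarrow> real measure" where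
  "spectral_measure \<tau> y = (THE \<mu>. is_spectral_measure \<tau> y \<mu>)"

definition cauchy_transform :: "real measure \<Rightarrow> complex \<Rightarrow> complex" where
  "cauchy_transform \<mu> z = (LINT t|\<mu>. 1 / (z - of_real t))"

text \<open>
  An element of \<open>\<complex>[z,w]\<close> is represented as a polynomial in \<open>w\<close> with coefficients in \<open>\<complex>[z]\<close>, so that
  \<open>poly (poly Q [:w:]) z\<close> is the value \<open>Q(z,w)\<close>.
\<close>

definition algebraic_element ::
  "(('h::complex_hilbert_space \<Rightarrow>\<^sub>L 'h) \<Rightarrow> complex) \<Rightarrow> ('h \<Rightarrow>\<^sub>L 'h) \<Rightarrow> bool" where
  "algebraic_element \<tau> y \<longleftrightarrow>
     (\<exists>Q :: complex poly poly. Q \<noteq> 0 \<and>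
        (\<forall>z. Im z > 0 \<longrightarrow>
           poly (poly Q [:cauchy_transform (spectral_measure \<tau> y) z:]) z = 0))"

text \<open>The value at \<open>0\<close> has to be given separately, since \<open>ln 0 = 0\<close> in the library.\<close>

definition log_abs :: "real \<Rightarrow> ereal" where
  "log_abs x = (if x = 0 then - \<infinity> else ereal (ln \<bar>x\<bar>))"

text \<open>
  Integral of an extended real function as the difference of the integrals of its positive and
  negative parts (\<^const>\<open>e2ennreal\<close> sends negative arguments to \<open>0\<close>).  It is meaningful only if one
  of the two is finite, the library having \<open>\<infinity> - \<infinity> = \<infinity>\<close>; below, the positive part of
  \<open>log |s - t|\<close> is bounded on the compact support of the measure.
\<close>

definition ereal_integral :: "'a measure \<Rightarrow> ('a \<Rightarrow> ereal) \<Rightarrow> ereal" where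
  "ereal_integral \<mu> f =
     enn2ereal (\<integral>\<^sup>+ x. e2ennreal (f x) \<partial>\<mu>) - enn2ereal (\<integral>\<^sup>+ x. e2ennreal (- f x) \<partial>\<mu>)"

definition free_entropy ::
  "(('h::complex_hilbert_space \<Rightarrow>\<^sub>L 'h) \<Rightarrow> complex) \<Rightarrow> ('h \<Rightarrow>\<^sub>L 'h) \<Rightarrow> ereal" where
  "free_entropy \<tau> y =
     ereal_integral (spectral_measure \<tau> y \<Otimes>\<^sub>M spectral_measure \<tau> y) (\<lambda>(s, t). log_abs (s - t))
     + ereal (3 / 4 + 1 / 2 * ln (2 * pi))"

end

theory Submission
  imports Defs "HOL-Computational_Algebra.Fundamental_Theorem_Algebra"
begin

text \<open>
  The logarithmic energy of a measure \<open>\<mu>\<close> is finite as soon as \<open>\<mu>\<close> is uniformly Holder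
  continuous, that is, the mass of every interval \<open>[x - \<epsilon>, x + \<epsilon>]\<close> centred in a bounded set carrying \<open>\<mu>\<close> is at most
  \<open>C \<epsilon>^\<delta>\<close> for some \<open>\<delta> > 0\<close> (\<open>log_energy_finite\<close>).  This mass is controlled by the Cauchy transform
  \<open>G\<close>: it is at most \<open>2 \<epsilon> |G(x + i \<epsilon>)|\<close>, because \<open>- Im G\<close> is a Poisson integral.  So it is enough
  that \<open>W = \<epsilon> G(x + i \<epsilon>)\<close>, which always has modulus at most \<open>1\<close>, is bounded by a power of \<open>\<epsilon>\<close>.

  Let \<open>Q(z, G(z)) = 0\<close> with leading coefficient \<open>q(z)\<close> in \<open>w\<close> and degree \<open>d\<close>.  Multiplying the equation by
  \<open>\<epsilon>^d\<close> gives \<open>|q(z)| |W|^d \<le> C \<epsilon>\<close>, which suffices as long as \<open>x\<close> is not too close to the real part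
  of a zero of \<open>q\<close> (\<open>leading_coeff_bound\<close>, \<open>poly_lower_bound_away_from_roots\<close>).  At a fixed real point \<open>b\<close>,
  the absence of an atom says that \<open>W\<close> tends to \<open>0\<close> along the vertical line above \<open>b\<close>; being an
  algebraic function of \<open>\<epsilon>\<close>, it then tends to \<open>0\<close> at a power rate (\<open>algebraic_small_root_bound\<close>,
  \<open>holder_at_point\<close>).  An interval is either far from all the finitely many bad points, or contained in a
  slightly larger interval around one of them; balancing the two cases gives the uniform bound
  (\<open>holder_uniform\<close>).

  All this presupposes that the spectral measure exists and is unique.  The functional
  \<open>p \<mapsto> \<tau> (p (y))\<close> is nonnegative on products of powers of \<open>R + t\<close> and \<open>R - t\<close> for \<open>R > \<parallel>y\<parallel>\<close>, so
  existence is the Hausdorff moment problem (\<open>hausdorff_moment_problem\<close>, \<open>spectral_measure_exists\<close>);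
  uniqueness holds because a characteristic function of a bounded variable is determined by the
  moments (\<open>moments_determine_distribution\<close>).
\<close>

section \<open>Polynomial equations with small parameter\<close>

lemma poly_poly_eq_sum:
  fixes P :: "'a::comm_semiring_1 poly poly"
  shows "poly (poly P [:w:]) z = (\<Sum>j\<le>degree P. poly (coeff P j) z * w ^ j)"
  by (simp add: poly_altdef[of P] poly_sum poly_power)

lemma poly_family_bounded:
  fixes f :: "nat \<Rightarrow> complex poly"
  obtains B where "B \<ge> 0" "\<And>j z. j \<le> d \<Longrightarrow> cmod z \<le> \<rho> \<Longrightarrow> cmod (poly (f j) z) \<le> B"
proof -
  have "\<exists>B. \<forall>z. cmod z \<le> \<rho> \<longrightarrow> cmod (poly (f j) z) \<le> B" for j
  proof -
    have "bounded (poly (f j) ` cball 0 \<rho>)"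
      by (intro compact_imp_bounded compact_continuous_image continuous_intros compact_cball)
    then show ?thesis
      unfolding bounded_iff by (meson image_eqI mem_cball_0)
  qed
  then obtain B where B: "\<And>j z. cmod z \<le> \<rho> \<Longrightarrow> cmod (poly (f j) z) \<le> B j"
    by metis
  show thesis
  proof
    show "0 \<le> (\<Sum>j\<le>d. \<bar>B j\<bar>)" by (simp add: sum_nonneg)
    fix j z assume "j \<le> d" "cmod z \<le> \<rho>"
    have "cmod (poly (f j) z) \<le> \<bar>B j\<bar>"
      using B[OF \<open>cmod z \<le> \<rho>\<close>, of j] by simp
    also have "\<dots> \<le> (\<Sum>j\<le>d. \<bar>B j\<bar>)"
      using \<open>j \<le> d\<close> by (intro member_le_sum) auto
    finally show "cmod (poly (f j) z) \<le> (\<Sum>j\<le>d. \<bar>B j\<bar>)" .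
  qed
qed

text \<open>
  A branch of an algebraic function that stays small near \<open>0\<close> tends to \<open>0\<close> at a power rate.  This
  replaces Puiseux expansions: cancel the largest power of \<open>z\<close> dividing all coefficients of \<open>P\<close>; then
  \<open>P(0,w)\<close> is a nonzero polynomial in \<open>w\<close>.  If its lowest term is \<open>c w^k\<close>, the higher powers of
  \<open>w\<close> are absorbed into it for small \<open>w\<close>, and everything else is a multiple of \<open>z\<close>.
\<close>

lemma algebraic_small_root_bound:
  fixes P :: "complex poly poly"
  assumes "P \<noteq> 0"
  obtains C \<eta> :: real and k :: nat where "C > 0" "\<eta> > 0"
    "\<And>z w. z \<noteq> 0 \<Longrightarrow> cmod z \<le> 1 \<Longrightarrow> cmod w \<le> \<eta> \<Longrightarrow> poly (poly P [:w:]) z = 0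
      \<Longrightarrow> cmod w ^ k \<le> C * cmod z"
proof -
  define d where "d = degree P"
  have ex: "\<exists>M j. coeff (coeff P j) M \<noteq> 0"
    using assms by (metis leading_coeff_0_iff)
  \<comment> \<open>\<open>z^M\<close> is the exact power of \<open>z\<close> dividing \<open>P\<close>, and \<open>\<Sum>j. c j w^j\<close> is \<open>P / z^M\<close> at \<open>z = 0\<close>.\<close>
  define M where "M = (LEAST M. \<exists>j. coeff (coeff P j) M \<noteq> 0)"
  have exM: "\<exists>j. coeff (coeff P j) M \<noteq> 0"
    unfolding M_def by (rule LeastI_ex) (use ex in blast)
  have low: "coeff (coeff P j) i = 0" if "i < M" for i j
    using not_less_Least[of i "\<lambda>M. \<exists>j. coeff (coeff P j) M \<noteq> 0"] that
    unfolding M_def by blast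
  define c where "c j = coeff (coeff P j) M" for j
  define k where "k = (LEAST j. c j \<noteq> 0)"
  have ck: "c k \<noteq> 0"
    unfolding k_def by (rule LeastI_ex) (use exM c_def in auto)
  have cless: "c j = 0" if "j < k" for j
    using not_less_Least[of j "\<lambda>j. c j \<noteq> 0"] that unfolding k_def by blast
  have kd: "k \<le> d"
    using ck unfolding c_def d_def by (metis coeff_0 le_degree)
  have "\<exists>s. coeff P j = monom 1 M * pCons (c j) s" for j
  proof -
    have "monom 1 M dvd coeff P j"
      using low by (simp add: monom_1_dvd_iff')
    then obtain r where r: "coeff P j = monom 1 M * r" by (elim dvdE)
    obtain a s where as: "r = pCons a s" by (cases r)
    have "c j = a" unfolding c_def r as by (simp add: coeff_monom_mult del: mult_pCons_right)
    then show ?thesis using r as by auto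
  qed
  then obtain s where s: "\<And>j. coeff P j = monom 1 M * pCons (c j) (s j)" by metis
  obtain B where B: "B \<ge> 0" "\<And>j z. j \<le> d \<Longrightarrow> cmod z \<le> 1 \<Longrightarrow> cmod (poly (s j) z) \<le> B"
    using poly_family_bounded by blast
  define E where "E = (\<Sum>j\<le>d. cmod (c j))"
  have E: "E > 0"
    using ck kd unfolding E_def by (intro sum_pos2[of _ k]) auto
  define \<eta> where "\<eta> = min 1 (cmod (c k) / (2 * E))"
  define C where "C = 2 * (real (d + 1) * B) / cmod (c k) + 1"
  show thesis
  proof
    show "C > 0" unfolding C_def using B(1) by (simp add: add_nonneg_pos)
    show "\<eta> > 0" unfolding \<eta>_def using E ck by simp
    fix z w :: complex
    assume z: "z \<noteq> 0" "cmod z \<le> 1" and w: "cmod w \<le> \<eta>" and eq: "poly (poly P [:w:]) z = 0"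
    have w1: "cmod w \<le> 1" using w unfolding \<eta>_def by simp
    have "z ^ M * (\<Sum>j\<le>d. (c j + z * poly (s j) z) * w ^ j) = 0"
      using eq unfolding poly_poly_eq_sum d_def[symmetric]
      by (simp only: s poly_monom poly_mult poly_pCons sum_distrib_left mult.assoc mult_1)
    then have "(\<Sum>j\<le>d. (c j + z * poly (s j) z) * w ^ j) = 0"
      using z by simp
    moreover have "(\<Sum>j\<le>d. (c j + z * poly (s j) z) * w ^ j)
        = (\<Sum>j\<le>d. c j * w ^ j) + z * (\<Sum>j\<le>d. poly (s j) z * w ^ j)"
      by (simp add: distrib_right sum.distrib sum_distrib_left mult.assoc)
    moreover have "(\<Sum>j\<le>d. c j * w ^ j) = c k * w ^ k + (\<Sum>j\<in>{..d} - {k}. c j * w ^ j)"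
      using kd by (subst sum.remove[of _ k]) auto
    ultimately have "c k * w ^ k
        + ((\<Sum>j\<in>{..d} - {k}. c j * w ^ j) + z * (\<Sum>j\<le>d. poly (s j) z * w ^ j)) = 0"
      by (simp only: add.assoc)
    then have "c k * w ^ k =
        - ((\<Sum>j\<in>{..d} - {k}. c j * w ^ j) + z * (\<Sum>j\<le>d. poly (s j) z * w ^ j))"
      by (simp only: eq_neg_iff_add_eq_0)
    then have "cmod (c k) * cmod w ^ k =
        cmod ((\<Sum>j\<in>{..d} - {k}. c j * w ^ j) + z * (\<Sum>j\<le>d. poly (s j) z * w ^ j))"
      by (simp only: norm_minus_cancel flip: norm_mult norm_power)
    also have "\<dots> \<le> cmod (\<Sum>j\<in>{..d} - {k}. c j * w ^ j)
        + cmod z * cmod (\<Sum>j\<le>d. poly (s j) z * w ^ j)"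
      by (rule order_trans[OF norm_triangle_ineq]) (simp add: norm_mult)
    also have "cmod (\<Sum>j\<in>{..d} - {k}. c j * w ^ j)
        \<le> (\<Sum>j\<in>{..d} - {k}. cmod (c j) * cmod w ^ Suc k)"
    proof (rule sum_norm_le)
      fix j assume j: "j \<in> {..d} - {k}"
      show "cmod (c j * w ^ j) \<le> cmod (c j) * cmod w ^ Suc k"
      proof (cases "j < k")
        case True then show ?thesis by (simp add: cless)
      next
        case False
        then have "cmod w ^ j \<le> cmod w ^ Suc k"
          using j w1 by (intro power_decreasing) auto
        then show ?thesis by (simp only: norm_mult norm_power mult_left_mono norm_ge_zero)
      qed
    qed
    also have "\<dots> \<le> E * cmod w ^ Suc k"
      unfolding E_def sum_distrib_right by (intro sum_mono2) auto
    also have "\<dots> \<le> (cmod (c k) / 2) * cmod w ^ k"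
    proof -
      have "E * cmod w \<le> E * (cmod (c k) / (2 * E))"
        using w E unfolding \<eta>_def by (intro mult_left_mono) auto
      also have "\<dots> = cmod (c k) / 2" using E by simp
      finally have "E * cmod w * cmod w ^ k \<le> cmod (c k) / 2 * cmod w ^ k"
        by (intro mult_right_mono) auto
      then show ?thesis by (simp only: power_Suc mult.assoc)
    qed
    also have "cmod (\<Sum>j\<le>d. poly (s j) z * w ^ j) \<le> real (d + 1) * B"
    proof -
      have "cmod (\<Sum>j\<le>d. poly (s j) z * w ^ j) \<le> (\<Sum>j\<le>d. B)"
      proof (rule sum_norm_le)
        fix j assume "j \<in> {..d}"
        then have "cmod (poly (s j) z) * cmod w ^ j \<le> B * 1"
          using B z w1 by (intro mult_mono power_le_one) auto
        then show "cmod (poly (s j) z * w ^ j) \<le> B" by (simp add: norm_mult norm_power)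
      qed
      then show ?thesis by simp
    qed
    finally have "cmod (c k) / 2 * cmod w ^ k \<le> cmod z * (real (d + 1) * B)"
      by (simp add: mult_left_mono)
    then have "cmod w ^ k \<le> 2 * (real (d + 1) * B) / cmod (c k) * cmod z"
      using ck by (simp add: field_simps)
    also have "\<dots> \<le> C * cmod z"
      unfolding C_def by (intro mult_right_mono) auto
    finally show "cmod w ^ k \<le> C * cmod z" .
  qed
qed

text \<open>
  Away from the zeros of its leading coefficient, an equation of degree \<open>d\<close> for \<open>w\<close> bounds \<open>w\<close>.
  The equation is multiplied by \<open>\<epsilon>^d\<close> and read as one for \<open>\<epsilon> w\<close>, which is known to be bounded: every
  term but the leading one then carries a factor \<open>\<epsilon>\<close>.
\<close>

lemma leading_coeff_bound:
  fixes Q :: "complex poly poly"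
  obtains C :: real where "C \<ge> 0"
    "\<And>z w \<epsilon>. cmod z \<le> \<rho> \<Longrightarrow> 0 < \<epsilon> \<Longrightarrow> \<epsilon> \<le> 1 \<Longrightarrow> \<epsilon> * cmod w \<le> 1 \<Longrightarrow>
      poly (poly Q [:w:]) z = 0 \<Longrightarrow>
      cmod (poly (lead_coeff Q) z) * (\<epsilon> * cmod w) ^ degree Q \<le> C * \<epsilon>"
proof -
  define d where "d = degree Q"
  obtain B where B: "B \<ge> 0" "\<And>j z. j \<le> d \<Longrightarrow> cmod z \<le> \<rho> \<Longrightarrow> cmod (poly (coeff Q j) z) \<le> B"
    using poly_family_bounded by blast
  show thesis
  proof
    show "0 \<le> real d * B" using B by simp
    fix z w :: complex and \<epsilon> :: real
    assume z: "cmod z \<le> \<rho>" and \<epsilon>: "0 < \<epsilon>" "\<epsilon> \<le> 1" and w: "\<epsilon> * cmod w \<le> 1"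
      and eq: "poly (poly Q [:w:]) z = 0"
    have "poly (coeff Q d) z * w ^ d = - (\<Sum>j<d. poly (coeff Q j) z * w ^ j)"
      using eq unfolding poly_poly_eq_sum d_def[symmetric]
      by (simp add: lessThan_Suc_atMost[symmetric] add_eq_0_iff)
    then have "cmod (poly (coeff Q d) z) * cmod w ^ d = cmod (\<Sum>j<d. poly (coeff Q j) z * w ^ j)"
      by (simp only: norm_minus_cancel flip: norm_mult norm_power)
    then have "cmod (poly (coeff Q d) z) * (\<epsilon> * cmod w) ^ d =
        \<epsilon> ^ d * cmod (\<Sum>j<d. poly (coeff Q j) z * w ^ j)"
      by (simp add: power_mult_distrib mult_ac)
    also have "cmod (\<Sum>j<d. poly (coeff Q j) z * w ^ j) \<le> (\<Sum>j<d. B * cmod w ^ j)"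
      using B z by (intro sum_norm_le) (simp add: norm_mult norm_power mult_right_mono)
    also have "\<epsilon> ^ d * (\<Sum>j<d. B * cmod w ^ j) = (\<Sum>j<d. \<epsilon> ^ d * (B * cmod w ^ j))"
      by (simp add: sum_distrib_left)
    also have "\<dots> \<le> (\<Sum>j<d. B * \<epsilon>)"
    proof (rule sum_mono)
      fix j assume "j \<in> {..<d}"
      then have j: "d = j + Suc (d - Suc j)" by simp
      have "\<epsilon> ^ d * (B * cmod w ^ j) = B * ((\<epsilon> * cmod w) ^ j * \<epsilon> ^ Suc (d - Suc j))"
        by (subst j, subst power_add) (simp add: power_mult_distrib)
      also have "\<dots> \<le> B * (1 * \<epsilon>)"
      proof (intro mult_left_mono mult_mono)
        show "(\<epsilon> * cmod w) ^ j \<le> 1" using w \<epsilon> by (intro power_le_one) auto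
        show "\<epsilon> ^ Suc (d - Suc j) \<le> \<epsilon>" using power_decreasing[of 1 "Suc (d - Suc j)" \<epsilon>] \<epsilon> by simp
      qed (use B \<epsilon> in auto)
      finally show "\<epsilon> ^ d * (B * cmod w ^ j) \<le> B * \<epsilon>" by simp
    qed
    finally show "cmod (poly (lead_coeff Q) z) * (\<epsilon> * cmod w) ^ degree Q \<le> real d * B * \<epsilon>"
      using \<epsilon> by (simp add: d_def mult_left_mono)
  qed
qed

text \<open>
  Only the real parts of the roots enter, since the points of interest lie just above the real axis
  and their distance to a root \<open>a\<close> is at least the distance of the real parts.
\<close>

lemma poly_lower_bound_away_from_roots:
  fixes q :: "complex poly"
  assumes "q \<noteq> 0"
  obtains B :: "real set" and c :: real and m :: nat where "finite B" "c > 0"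
    "\<And>z D. 0 \<le> D \<Longrightarrow> (\<And>b. b \<in> B \<Longrightarrow> D \<le> \<bar>Re z - b\<bar>) \<Longrightarrow> c * D ^ m \<le> cmod (poly q z)"
proof -
  define A where "A = {a. poly q a = 0}"
  have A: "finite A" unfolding A_def using assms by (rule poly_roots_finite)
  show thesis
  proof
    show "finite (Re ` A)" using A by simp
    show "cmod (lead_coeff q) > 0" using assms by simp
    fix z and D :: real
    assume D: "0 \<le> D" and far: "\<And>b. b \<in> Re ` A \<Longrightarrow> D \<le> \<bar>Re z - b\<bar>"
    have "D ^ (\<Sum>a\<in>A. order a q) = (\<Prod>a\<in>A. D ^ order a q)"
      by (simp add: power_sum)
    also have "\<dots> \<le> (\<Prod>a\<in>A. cmod (z - a) ^ order a q)"
    proof (intro prod_mono conjI power_mono)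
      fix a assume "a \<in> A"
      then have "D \<le> \<bar>Re z - Re a\<bar>" using far by blast
      also have "\<dots> \<le> cmod (z - a)" using abs_Re_le_cmod[of "z - a"] by simp
      finally show "D \<le> cmod (z - a)" .
    qed (use D in auto)
    finally have "cmod (lead_coeff q) * D ^ (\<Sum>a\<in>A. order a q)
        \<le> cmod (lead_coeff q) * (\<Prod>a\<in>A. cmod (z - a) ^ order a q)"
      by (intro mult_left_mono) auto
    also have "\<dots> = cmod (poly q z)"
    proof -
      have "poly q z = poly (smult (lead_coeff q) (\<Prod>a\<in>A. [:- a, 1:] ^ order a q)) z"
        unfolding A_def by (simp only: complex_poly_decompose)
      also have "\<dots> = lead_coeff q * (\<Prod>a\<in>A. (z - a) ^ order a q)"
        by (simp add: poly_prod poly_power)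
      finally show ?thesis by (simp only: norm_mult norm_power flip: prod_norm)
    qed
    finally show "cmod (lead_coeff q) * D ^ (\<Sum>a\<in>A. order a q) \<le> cmod (poly q z)" .
  qed
qed

section \<open>Measures with algebraic Cauchy transform\<close>

lemma cauchy_kernel_bounds:
  fixes x t \<epsilon> \<delta> :: real
  assumes "\<epsilon> > 0"
  shows "cmod (1 / (Complex x \<epsilon> - of_real t)) \<le> 1 / \<epsilon>"
    and "\<bar>x - t\<bar> \<le> \<epsilon> \<Longrightarrow> 1 / (2 * \<epsilon>) \<le> - Im (1 / (Complex x \<epsilon> - of_real t))"
    and "0 \<le> - Im (1 / (Complex x \<epsilon> - of_real t))"
    and "0 < \<delta> \<Longrightarrow> \<delta> \<le> \<bar>x - t\<bar> \<Longrightarrow> cmod (1 / (Complex x \<epsilon> - of_real t)) \<le> 1 / \<delta>"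
proof -
  have "\<epsilon> \<le> cmod (Complex x \<epsilon> - of_real t)"
    using abs_Im_le_cmod[of "Complex x \<epsilon> - of_real t"] assms by simp
  then show "cmod (1 / (Complex x \<epsilon> - of_real t)) \<le> 1 / \<epsilon>"
    using assms by (simp add: norm_divide frac_le)
  have Im_eq: "- Im (1 / (Complex x \<epsilon> - of_real t)) = \<epsilon> / ((x - t)\<^sup>2 + \<epsilon>\<^sup>2)"
    by (simp add: Im_divide)
  have pos: "(x - t)\<^sup>2 + \<epsilon>\<^sup>2 > 0" using assms by (simp add: add_nonneg_pos)
  show "0 \<le> - Im (1 / (Complex x \<epsilon> - of_real t))"
    unfolding Im_eq using assms by simp
  show "1 / (2 * \<epsilon>) \<le> - Im (1 / (Complex x \<epsilon> - of_real t))" if "\<bar>x - t\<bar> \<le> \<epsilon>"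
  proof -
    have "(x - t)\<^sup>2 \<le> \<epsilon>\<^sup>2" using that assms by (simp add: abs_le_square_iff[symmetric])
    then have "(x - t)\<^sup>2 + \<epsilon>\<^sup>2 \<le> 2 * \<epsilon>\<^sup>2" by simp
    then have "\<epsilon> / (2 * \<epsilon>\<^sup>2) \<le> \<epsilon> / ((x - t)\<^sup>2 + \<epsilon>\<^sup>2)"
      using assms pos by (intro divide_left_mono) auto
    then show ?thesis unfolding Im_eq using assms by (simp add: power2_eq_square)
  qed
  show "cmod (1 / (Complex x \<epsilon> - of_real t)) \<le> 1 / \<delta>" if "0 < \<delta>" "\<delta> \<le> \<bar>x - t\<bar>"
  proof -
    have "\<delta> \<le> cmod (Complex x \<epsilon> - of_real t)"
      using abs_Re_le_cmod[of "Complex x \<epsilon> - of_real t"] that by simp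
    then show ?thesis using that by (simp add: norm_divide frac_le)
  qed
qed

context real_distribution
begin

lemma integrable_cauchy_kernel:
  assumes "\<epsilon> > 0"
  shows "integrable M (\<lambda>t. 1 / (Complex x \<epsilon> - of_real t))"
proof (rule integrable_const_bound[where B = "1 / \<epsilon>"])
  show "AE t in M. cmod (1 / (Complex x \<epsilon> - of_real t)) \<le> 1 / \<epsilon>"
    using cauchy_kernel_bounds(1)[OF assms] by simp
qed measurable

lemma cauchy_transform_le:
  assumes "\<epsilon> > 0"
  shows "\<epsilon> * cmod (cauchy_transform M (Complex x \<epsilon>)) \<le> 1"
proof -
  have "cmod (cauchy_transform M (Complex x \<epsilon>))
      \<le> (LINT t|M. cmod (1 / (Complex x \<epsilon> - of_real t)))"
    unfolding cauchy_transform_def by (rule integral_norm_bound)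
  also have "\<dots> \<le> (LINT t|M. 1 / \<epsilon>)"
    by (rule integral_mono)
      (use cauchy_kernel_bounds(1)[OF assms] integrable_cauchy_kernel[OF assms] in auto)
  finally show ?thesis using assms prob_space by (simp add: field_simps)
qed

text \<open>
  The negative imaginary part of the kernel is the Poisson kernel \<open>\<epsilon> / ((x - t)^2 + \<epsilon>^2)\<close>, which is at
  least \<open>1 / (2 \<epsilon>)\<close> on the interval.
\<close>

lemma interval_le_cauchy_transform:
  assumes "\<epsilon> > 0"
  shows "prob {x - \<epsilon>..x + \<epsilon>} \<le> 2 * (\<epsilon> * cmod (cauchy_transform M (Complex x \<epsilon>)))"
proof -
  have "prob {x - \<epsilon>..x + \<epsilon>} / (2 * \<epsilon>) = (LINT t|M. indicator {x - \<epsilon>..x + \<epsilon>} t * (1 / (2 * \<epsilon>)))"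
    by simp
  also have "\<dots> \<le> (LINT t|M. - Im (1 / (Complex x \<epsilon> - of_real t)))"
  proof (rule integral_mono)
    show "integrable M (\<lambda>t. indicator {x - \<epsilon>..x + \<epsilon>} t * (1 / (2 * \<epsilon>)))"
      by (intro integrable_mult_left integrable_real_indicator) (auto simp: emeasure_eq_measure)
    show "integrable M (\<lambda>t. - Im (1 / (Complex x \<epsilon> - of_real t)))"
      using integrable_cauchy_kernel[OF assms, of x] by (intro integrable_minus integrable_Im)
    fix t
    show "indicator {x - \<epsilon>..x + \<epsilon>} t * (1 / (2 * \<epsilon>)) \<le> - Im (1 / (Complex x \<epsilon> - of_real t))"
      using cauchy_kernel_bounds(2,3)[OF assms, of x t]
      by (cases "t \<in> {x - \<epsilon>..x + \<epsilon>}") (auto simp: abs_le_iff)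
  qed
  also have "\<dots> = - Im (cauchy_transform M (Complex x \<epsilon>))"
    unfolding cauchy_transform_def using integrable_cauchy_kernel[OF assms, of x] by simp
  also have "\<dots> \<le> cmod (cauchy_transform M (Complex x \<epsilon>))"
    using abs_Im_le_cmod[of "cauchy_transform M (Complex x \<epsilon>)"] by simp
  finally show ?thesis using assms by (simp add: field_simps)
qed

text \<open>
  The kernel is at most \<open>1/\<epsilon>\<close> everywhere and at most \<open>1/\<delta>\<close> outside the interval.  For \<open>\<epsilon>\<close> tending
  to \<open>0\<close> this shows that \<open>\<epsilon> G(x + i \<epsilon>)\<close> tends to \<open>0\<close> if \<open>x\<close> is not an atom.
\<close>

lemma cauchy_transform_le_interval:
  assumes "\<epsilon> > 0" "\<delta> > 0"
  shows "\<epsilon> * cmod (cauchy_transform M (Complex x \<epsilon>)) \<le> prob {x - \<delta>..x + \<delta>} + \<epsilon> / \<delta>"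
proof -
  have int: "integrable M (\<lambda>t. indicator {x - \<delta>..x + \<delta>} t * (1 / \<epsilon>))"
    by (intro integrable_mult_left integrable_real_indicator) (auto simp: emeasure_eq_measure)
  have "cmod (cauchy_transform M (Complex x \<epsilon>))
      \<le> (LINT t|M. cmod (1 / (Complex x \<epsilon> - of_real t)))"
    unfolding cauchy_transform_def by (rule integral_norm_bound)
  also have "\<dots> \<le> (LINT t|M. indicator {x - \<delta>..x + \<delta>} t * (1 / \<epsilon>) + 1 / \<delta>)"
  proof (rule integral_mono)
    show "integrable M (\<lambda>t. cmod (1 / (Complex x \<epsilon> - of_real t)))"
      using integrable_cauchy_kernel[OF assms(1)] by (rule integrable_norm)
    show "integrable M (\<lambda>t. indicator {x - \<delta>..x + \<delta>} t * (1 / \<epsilon>) + 1 / \<delta>)"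
      using int by (rule Bochner_Integration.integrable_add) simp
    fix t
    show "cmod (1 / (Complex x \<epsilon> - of_real t)) \<le> indicator {x - \<delta>..x + \<delta>} t * (1 / \<epsilon>) + 1 / \<delta>"
    proof (cases "t \<in> {x - \<delta>..x + \<delta>}")
      case True
      moreover have "0 \<le> 1 / \<delta>" using assms by simp
      ultimately show ?thesis
        using cauchy_kernel_bounds(1)[OF assms(1), of x t]
        by (simp only: indicator_simps mult_1)
    next
      case False
      then have "\<delta> \<le> \<bar>x - t\<bar>" by auto
      then have "cmod (1 / (Complex x \<epsilon> - of_real t)) \<le> 1 / \<delta>"
        by (rule cauchy_kernel_bounds(4)[OF assms])
      with False show ?thesis by (simp only: indicator_simps not_False_eq_True mult_zero_left add_0)
    qed
  qed
  also have "\<dots> = prob {x - \<delta>..x + \<delta>} / \<epsilon> + 1 / \<delta>"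
    using int prob_space by simp
  finally have "\<epsilon> * cmod (cauchy_transform M (Complex x \<epsilon>))
      \<le> \<epsilon> * (prob {x - \<delta>..x + \<delta>} / \<epsilon> + 1 / \<delta>)"
    using assms by (intro mult_left_mono) auto
  also have "\<dots> = prob {x - \<delta>..x + \<delta>} + \<epsilon> / \<delta>"
    using assms by (simp add: distrib_left)
  finally show ?thesis .
qed

lemma small_interval:
  assumes "prob {b} = 0" "\<eta> > 0"
  obtains \<delta> where "\<delta> > 0" "prob {b - \<delta>..b + \<delta>} < \<eta>"
proof -
  define A where "A n = {b - 1 / real (Suc n)..b + 1 / real (Suc n)}" for n
  have "(\<lambda>n. prob (A n)) \<longlonglongrightarrow> prob (\<Inter>n. A n)"
  proof (rule finite_Lim_measure_decseq)
    show "decseq A"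
      unfolding A_def decseq_Suc_iff
    proof (intro allI)
      fix n
      have "1 / real (Suc (Suc n)) \<le> 1 / real (Suc n)" by (simp add: frac_le)
      then show "{b - 1 / real (Suc (Suc n))..b + 1 / real (Suc (Suc n))}
          \<subseteq> {b - 1 / real (Suc n)..b + 1 / real (Suc n)}" by auto
    qed
  qed (auto simp: A_def)
  also have "(\<Inter>n. A n) = {b}"
  proof (intro equalityI subsetI)
    fix t assume t: "t \<in> (\<Inter>n. A n)"
    show "t \<in> {b}"
    proof (rule ccontr)
      assume "t \<notin> {b}"
      then obtain n where "inverse (real (Suc n)) < \<bar>t - b\<bar>"
        using reals_Archimedean[of "\<bar>t - b\<bar>"] by auto
      moreover have "t \<in> A n" using t by blast
      then have "\<bar>t - b\<bar> \<le> 1 / real (Suc n)" unfolding A_def by (auto simp: abs_le_iff)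
      ultimately show False by (simp add: inverse_eq_divide)
    qed
  qed (auto simp: A_def)
  finally have "(\<lambda>n. prob (A n)) \<longlonglongrightarrow> 0" using assms by simp
  then have "eventually (\<lambda>n. prob (A n) < \<eta>) sequentially"
    using assms by (intro order_tendstoD)
  then obtain n where "prob (A n) < \<eta>" by (auto simp: eventually_sequentially)
  then show thesis unfolding A_def by (intro that[of "1 / real (Suc n)"]) auto
qed

end

text \<open>
  The exponent \<open>Suc k\<close> in place of \<open>k\<close> covers \<open>k = 0\<close> without a case distinction; it is available
  because \<open>w \<le> 1\<close>.
\<close>

lemma le_powr_of_power_le:
  fixes w c :: real
  assumes "0 \<le> w" "w \<le> 1" "w ^ k \<le> c"
  shows "w \<le> c powr (1 / real (Suc k))"
proof (cases "w = 0")
  case False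
  then have w: "w > 0" using assms by simp
  have "w ^ Suc k \<le> 1 * w ^ k" using assms by (simp add: mult_left_le_one_le)
  then have "w ^ Suc k \<le> c" using assms by simp
  then have "(w ^ Suc k) powr (1 / real (Suc k)) \<le> c powr (1 / real (Suc k))"
    using assms by (intro powr_mono2) auto
  moreover have "(w ^ Suc k) powr (1 / real (Suc k)) = w"
    using w by (subst powr_realpow[symmetric]) (auto simp: powr_powr simp del: power_Suc)
  ultimately show ?thesis by simp
qed simp

text \<open>
  With \<open>z = i \<epsilon>\<close>, the function \<open>w = z G(b + z)\<close> tends to the mass of the atom at \<open>b\<close>, which is \<open>0\<close>,
  and satisfies the algebraic equation \<open>z^d Q(b + z, w / z) = 0\<close>.  Hence \<open>w\<close> decays at a power rate,
  and \<open>2 |w|\<close> bounds the mass of \<open>[b - \<epsilon>, b + \<epsilon>]\<close>.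
\<close>

lemma (in real_distribution) holder_at_point:
  fixes Q :: "complex poly poly"
  assumes "Q \<noteq> 0"
    and eq: "\<And>z. Im z > 0 \<Longrightarrow> poly (poly Q [:cauchy_transform M z:]) z = 0"
    and "prob {b} = 0"
  obtains C \<delta> :: real where "C \<ge> 0" "\<delta> > 0"
    "\<And>\<epsilon>. \<epsilon> > 0 \<Longrightarrow> prob {b - \<epsilon>..b + \<epsilon>} \<le> C * \<epsilon> powr \<delta>"
proof -
  define d where "d = degree Q"
  define P where "P = (\<Sum>j\<le>d. monom ((coeff Q j \<circ>\<^sub>p [:of_real b, 1:]) * monom 1 (d - j)) j)"
  have "coeff P d = coeff Q d \<circ>\<^sub>p [:of_real b, 1:]"
    unfolding P_def coeff_sum by (simp add: coeff_monom if_distrib cong: if_cong)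
  moreover have "coeff Q d \<circ>\<^sub>p [:of_real b, 1:] \<noteq> 0"
    using assms(1) by (simp add: d_def pcompose_eq_0_iff)
  ultimately have "P \<noteq> 0" by auto
  have P: "poly (poly P [:w:]) z = (\<Sum>j\<le>d. poly (coeff Q j) (of_real b + z) * z ^ (d - j) * w ^ j)"
    for w z
    unfolding P_def by (simp add: poly_sum poly_monom poly_pcompose poly_power)
  obtain C0 \<eta> :: real and k :: nat where C0: "C0 > 0" and \<eta>: "\<eta> > 0"
    and root: "\<And>z w. z \<noteq> 0 \<Longrightarrow> cmod z \<le> 1 \<Longrightarrow> cmod w \<le> \<eta> \<Longrightarrow> poly (poly P [:w:]) z = 0
      \<Longrightarrow> cmod w ^ k \<le> C0 * cmod z"
    using algebraic_small_root_bound[OF \<open>P \<noteq> 0\<close>] by blast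
  obtain \<delta>0 where \<delta>0: "\<delta>0 > 0" "prob {b - \<delta>0..b + \<delta>0} < \<eta> / 2"
    using small_interval[OF assms(3), of "\<eta> / 2"] \<eta> by auto
  define \<epsilon>0 where "\<epsilon>0 = min 1 (\<delta>0 * \<eta> / 2)"
  have \<epsilon>0: "\<epsilon>0 > 0" unfolding \<epsilon>0_def using \<delta>0 \<eta> by simp
  define \<delta> where "\<delta> = 1 / real (Suc k)"
  define C where "C = 2 * C0 powr \<delta> + (1 / \<epsilon>0) powr \<delta>"
  have near: "prob {b - \<epsilon>..b + \<epsilon>} \<le> 2 * (C0 powr \<delta> * \<epsilon> powr \<delta>)" if \<epsilon>: "0 < \<epsilon>" "\<epsilon> \<le> \<epsilon>0" for \<epsilon>
  proof -
    define z where "z = \<i> * of_real \<epsilon>"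
    have bz: "Complex b \<epsilon> = of_real b + z" unfolding z_def by (simp add: complex_eq_iff)
    define w where "w = z * cauchy_transform M (Complex b \<epsilon>)"
    have cz: "cmod z = \<epsilon>" unfolding z_def using \<epsilon> by (simp add: norm_mult)
    have cw: "cmod w = \<epsilon> * cmod (cauchy_transform M (Complex b \<epsilon>))"
      unfolding w_def by (simp add: norm_mult cz)
    have "poly (poly P [:w:]) z =
        (\<Sum>j\<le>d. z ^ d * (poly (coeff Q j) (Complex b \<epsilon>) * cauchy_transform M (Complex b \<epsilon>) ^ j))"
      unfolding P bz[symmetric]
    proof (rule sum.cong[OF refl])
      fix j assume "j \<in> {..d}"
      then have "z ^ d = z ^ (d - j) * z ^ j" by (simp add: power_add[symmetric])
      then show "poly (coeff Q j) (Complex b \<epsilon>) * z ^ (d - j) * w ^ j =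
          z ^ d * (poly (coeff Q j) (Complex b \<epsilon>) * cauchy_transform M (Complex b \<epsilon>) ^ j)"
        by (simp add: w_def power_mult_distrib)
    qed
    also have "\<dots> = z ^ d * poly (poly Q [:cauchy_transform M (Complex b \<epsilon>):]) (Complex b \<epsilon>)"
      unfolding poly_poly_eq_sum d_def[symmetric] by (simp add: sum_distrib_left)
    also have "\<dots> = 0" using eq[of "Complex b \<epsilon>"] \<epsilon> by simp
    finally have Pz: "poly (poly P [:w:]) z = 0" .
    have "cmod w \<le> prob {b - \<delta>0..b + \<delta>0} + \<epsilon> / \<delta>0"
      unfolding cw by (rule cauchy_transform_le_interval) fact+
    also have "\<epsilon> / \<delta>0 \<le> (\<delta>0 * \<eta> / 2) / \<delta>0"
      using \<epsilon> \<delta>0 unfolding \<epsilon>0_def by (intro divide_right_mono) auto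
    also have "\<dots> = \<eta> / 2" using \<delta>0 by simp
    finally have "cmod w \<le> \<eta>" using \<delta>0 by simp
    then have "cmod w ^ k \<le> C0 * \<epsilon>"
      using root[of z w] Pz cz \<epsilon> unfolding \<epsilon>0_def by auto
    moreover have "cmod w \<le> 1" unfolding cw using \<epsilon> by (intro cauchy_transform_le)
    ultimately have "cmod w \<le> (C0 * \<epsilon>) powr \<delta>"
      unfolding \<delta>_def by (intro le_powr_of_power_le) auto
    then have "cmod w \<le> C0 powr \<delta> * \<epsilon> powr \<delta>"
      using C0 \<epsilon> by (simp add: powr_mult)
    moreover have "prob {b - \<epsilon>..b + \<epsilon>} \<le> 2 * cmod w"
      unfolding cw using \<epsilon> by (intro interval_le_cauchy_transform)
    ultimately show ?thesis by simp
  qed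
  show thesis
  proof
    show "C \<ge> 0" "\<delta> > 0" unfolding C_def \<delta>_def by auto
    fix \<epsilon> :: real assume \<epsilon>: "\<epsilon> > 0"
    show "prob {b - \<epsilon>..b + \<epsilon>} \<le> C * \<epsilon> powr \<delta>"
    proof (cases "\<epsilon> \<le> \<epsilon>0")
      case True
      have "2 * (C0 powr \<delta> * \<epsilon> powr \<delta>) \<le> C * \<epsilon> powr \<delta>"
        unfolding C_def by (simp add: algebra_simps)
      then show ?thesis using near[OF \<epsilon> True] by simp
    next
      case False
      have "prob {b - \<epsilon>..b + \<epsilon>} \<le> 1" by simp
      also have "1 \<le> (\<epsilon> / \<epsilon>0) powr \<delta>"
        using False \<epsilon>0 unfolding \<delta>_def by (intro ge_one_powr_ge_zero) auto
      also have "\<dots> = (1 / \<epsilon>0) powr \<delta> * \<epsilon> powr \<delta>"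
        using \<epsilon> \<epsilon>0 by (subst powr_mult[symmetric]) auto
      also have "\<dots> \<le> C * \<epsilon> powr \<delta>"
        unfolding C_def by (simp add: algebra_simps)
      finally show ?thesis .
    qed
  qed
qed

lemma (in real_distribution) holder_near_finite_set:
  fixes Q :: "complex poly poly"
  assumes "Q \<noteq> 0"
    and eq: "\<And>z. Im z > 0 \<Longrightarrow> poly (poly Q [:cauchy_transform M z:]) z = 0"
    and "\<And>b. prob {b} = 0"
    and "finite B"
  shows "\<exists>C \<delta>. C \<ge> 0 \<and> \<delta> > 0 \<and>
    (\<forall>b\<in>B. \<forall>\<epsilon>. 0 < \<epsilon> \<and> \<epsilon> \<le> 1 \<longrightarrow> prob {b - 2 * \<epsilon>..b + 2 * \<epsilon>} \<le> C * \<epsilon> powr \<delta>)"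
  using \<open>finite B\<close>
proof induction
  case empty
  show ?case by (auto intro!: exI[of _ 1])
next
  case (insert a B)
  then obtain C1 \<delta>1 where 1: "C1 \<ge> 0" "\<delta>1 > 0"
    "\<And>b \<epsilon>. b \<in> B \<Longrightarrow> 0 < \<epsilon> \<Longrightarrow> \<epsilon> \<le> 1 \<Longrightarrow> prob {b - 2 * \<epsilon>..b + 2 * \<epsilon>} \<le> C1 * \<epsilon> powr \<delta>1"
    by blast
  obtain C2 \<delta>2 where 2: "C2 \<ge> 0" "\<delta>2 > 0"
    "\<And>\<epsilon>. \<epsilon> > 0 \<Longrightarrow> prob {a - \<epsilon>..a + \<epsilon>} \<le> C2 * \<epsilon> powr \<delta>2"
    using holder_at_point[OF assms(1) eq assms(3), of a] by metis
  define \<delta> where "\<delta> = min \<delta>1 \<delta>2"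
  define C where "C = C1 + C2 * 2 powr \<delta>2"
  have C: "C1 \<le> C" "C2 * 2 powr \<delta>2 \<le> C" "C \<ge> 0"
    using 1 2 unfolding C_def by auto
  have mono: "c * \<epsilon> powr \<delta>' \<le> C * \<epsilon> powr \<delta>"
    if "0 < \<epsilon>" "\<epsilon> \<le> 1" "c \<le> C" "\<delta> \<le> \<delta>'" for \<epsilon> c \<delta>'
    using that C by (intro mult_mono powr_mono') auto
  have "prob {b - 2 * \<epsilon>..b + 2 * \<epsilon>} \<le> C * \<epsilon> powr \<delta>"
    if "b \<in> insert a B" and \<epsilon>: "0 < \<epsilon>" "\<epsilon> \<le> 1" for b \<epsilon>
  proof (cases "b \<in> B")
    case True
    then have "prob {b - 2 * \<epsilon>..b + 2 * \<epsilon>} \<le> C1 * \<epsilon> powr \<delta>1"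
      using 1(3) \<epsilon> by blast
    also have "\<dots> \<le> C * \<epsilon> powr \<delta>" using \<epsilon> C by (intro mono) (auto simp: \<delta>_def)
    finally show ?thesis .
  next
    case False
    then have "b = a" using that by simp
    then have "prob {b - 2 * \<epsilon>..b + 2 * \<epsilon>} \<le> C2 * (2 * \<epsilon>) powr \<delta>2"
      using 2(3)[of "2 * \<epsilon>"] \<epsilon> by simp
    also have "\<dots> = (C2 * 2 powr \<delta>2) * \<epsilon> powr \<delta>2"
      using \<epsilon> by (simp add: powr_mult)
    also have "\<dots> \<le> C * \<epsilon> powr \<delta>" using \<epsilon> C by (intro mono) (auto simp: \<delta>_def)
    finally show ?thesis .
  qed
  moreover have "\<delta> > 0" using 1 2 by (simp add: \<delta>_def)
  ultimately show ?case using C by blast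
qed

text \<open>
  The constants at a single point are not uniform, and the bound from the leading coefficient \<open>q\<close> of
  \<open>Q\<close> degenerates near the finitely many real parts \<open>b\<close> of its roots.  The two regimes overlap: if \<open>x\<close> is at
  distance at least \<open>D\<close> from all \<open>b\<close>, then \<open>w = \<epsilon> G(x + i \<epsilon>)\<close> satisfies \<open>D^m |w|^d \<le> const * \<epsilon>\<close>;
  otherwise \<open>[x - \<epsilon>, x + \<epsilon>]\<close> lies within \<open>2 D\<close> of some \<open>b\<close>, provided \<open>\<epsilon> \<le> D\<close>.  Taking for \<open>D\<close> a
  power of \<open>\<epsilon>\<close> with exponent below \<open>1/m\<close> gives a power of \<open>\<epsilon>\<close> in both cases.
\<close>

lemma (in real_distribution) holder_uniform:
  fixes Q :: "complex poly poly"
  assumes "Q \<noteq> 0"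
    and eq: "\<And>z. Im z > 0 \<Longrightarrow> poly (poly Q [:cauchy_transform M z:]) z = 0"
    and "\<And>b. prob {b} = 0"
  obtains C \<delta> :: real where "C \<ge> 0" "\<delta> > 0"
    "\<And>x \<epsilon>. \<bar>x\<bar> \<le> \<rho> \<Longrightarrow> 0 < \<epsilon> \<Longrightarrow> \<epsilon> \<le> 1 \<Longrightarrow> prob {x - \<epsilon>..x + \<epsilon>} \<le> C * \<epsilon> powr \<delta>"
proof -
  define d where "d = degree Q"
  have "lead_coeff Q \<noteq> 0" using assms(1) by simp
  then obtain B :: "real set" and c :: real and m :: nat where B: "finite B" and c: "c > 0"
    and lower: "\<And>z D. 0 \<le> D \<Longrightarrow> (\<And>b. b \<in> B \<Longrightarrow> D \<le> \<bar>Re z - b\<bar>) \<Longrightarrow>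
      c * D ^ m \<le> cmod (poly (lead_coeff Q) z)"
    using poly_lower_bound_away_from_roots by blast
  obtain C1 :: real where C1: "C1 \<ge> 0" and lead:
    "\<And>z w \<epsilon>. cmod z \<le> \<rho> + 1 \<Longrightarrow> 0 < \<epsilon> \<Longrightarrow> \<epsilon> \<le> 1 \<Longrightarrow> \<epsilon> * cmod w \<le> 1 \<Longrightarrow>
      poly (poly Q [:w:]) z = 0 \<Longrightarrow> cmod (poly (lead_coeff Q) z) * (\<epsilon> * cmod w) ^ d \<le> C1 * \<epsilon>"
    using leading_coeff_bound[of "\<rho> + 1" Q] unfolding d_def by blast
  obtain C2 \<delta>2 where C2: "C2 \<ge> 0" and \<delta>2: "\<delta>2 > 0" and nearB:
    "\<And>b \<epsilon>. b \<in> B \<Longrightarrow> 0 < \<epsilon> \<Longrightarrow> \<epsilon> \<le> 1 \<Longrightarrow> prob {b - 2 * \<epsilon>..b + 2 * \<epsilon>} \<le> C2 * \<epsilon> powr \<delta>2"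
    using holder_near_finite_set[OF assms B] by blast
  \<comment> \<open>This exponent makes \<open>\<epsilon> / D^m\<close> at most \<open>\<epsilon>^(1/2)\<close> for \<open>D = \<epsilon>^\<theta>\<close>.\<close>
  define \<theta> where "\<theta> = 1 / (2 * real (Suc m))"
  have \<theta>: "0 < \<theta>" "\<theta> \<le> 1" "real m * \<theta> \<le> 1 / 2"
    unfolding \<theta>_def by (auto simp: field_simps)
  define \<delta>1 where "\<delta>1 = 1 / (2 * real (Suc d))"
  define \<delta> where "\<delta> = min \<delta>1 (\<theta> * \<delta>2)"
  have \<delta>: "\<delta> > 0" unfolding \<delta>_def \<delta>1_def using \<theta> \<delta>2 by simp
  define A where "A = 2 * (C1 / c) powr (1 / real (Suc d))"
  have A: "A \<ge> 0" unfolding A_def by simp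
  show thesis
  proof
    show "A + C2 \<ge> 0" using A C2 by simp
    show "\<delta> > 0" by fact
    fix x \<epsilon> :: real assume x: "\<bar>x\<bar> \<le> \<rho>" and \<epsilon>: "0 < \<epsilon>" "\<epsilon> \<le> 1"
    define D where "D = \<epsilon> powr \<theta>"
    have D: "0 < D" "D \<le> 1" "\<epsilon> \<le> D"
    proof -
      show "0 < D" "D \<le> 1" unfolding D_def using \<epsilon> \<theta> by (auto simp: powr_le1)
      have "\<epsilon> powr 1 \<le> \<epsilon> powr \<theta>" using \<epsilon> \<theta> by (intro powr_mono') auto
      then show "\<epsilon> \<le> D" unfolding D_def using \<epsilon> by simp
    qed
    have mono: "a * \<epsilon> powr \<delta>' \<le> (A + C2) * \<epsilon> powr \<delta>"
      if "a \<le> A + C2" "\<delta> \<le> \<delta>'" for a \<delta>'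
      using that A C2 \<epsilon> by (intro mult_mono powr_mono') auto
    show "prob {x - \<epsilon>..x + \<epsilon>} \<le> (A + C2) * \<epsilon> powr \<delta>"
    proof (cases "\<forall>b\<in>B. D \<le> \<bar>x - b\<bar>")
      case True
      define w where "w = cauchy_transform M (Complex x \<epsilon>)"
      have w1: "\<epsilon> * cmod w \<le> 1" unfolding w_def using \<epsilon> by (intro cauchy_transform_le)
      have "cmod (Complex x \<epsilon>) \<le> \<rho> + 1"
        using cmod_le[of "Complex x \<epsilon>"] x \<epsilon> by simp
      then have "cmod (poly (lead_coeff Q) (Complex x \<epsilon>)) * (\<epsilon> * cmod w) ^ d \<le> C1 * \<epsilon>"
        using lead[of "Complex x \<epsilon>" \<epsilon> w] \<epsilon> w1 eq[of "Complex x \<epsilon>"] unfolding w_def by simp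
      moreover have "c * D ^ m \<le> cmod (poly (lead_coeff Q) (Complex x \<epsilon>))"
        using True D by (intro lower) auto
      then have "c * D ^ m * (\<epsilon> * cmod w) ^ d
          \<le> cmod (poly (lead_coeff Q) (Complex x \<epsilon>)) * (\<epsilon> * cmod w) ^ d"
        using \<epsilon> by (intro mult_right_mono) auto
      ultimately have "c * D ^ m * (\<epsilon> * cmod w) ^ d \<le> C1 * \<epsilon>" by linarith
      then have "(\<epsilon> * cmod w) ^ d \<le> C1 / c * (\<epsilon> / D ^ m)"
        using c D by (simp add: field_simps)
      also have "\<epsilon> / D ^ m = \<epsilon> powr (1 - real m * \<theta>)"
        unfolding D_def using \<epsilon>
        by (simp add: powr_diff powr_realpow[symmetric] powr_powr mult.commute)
      also have "C1 / c * \<dots> \<le> C1 / c * \<epsilon> powr (1 / 2)"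
        using C1 c \<epsilon> \<theta> by (intro mult_left_mono powr_mono') auto
      finally have "\<epsilon> * cmod w \<le> (C1 / c * \<epsilon> powr (1 / 2)) powr (1 / real (Suc d))"
        using w1 \<epsilon> by (intro le_powr_of_power_le) auto
      also have "\<dots> = (C1 / c) powr (1 / real (Suc d)) * \<epsilon> powr \<delta>1"
        unfolding \<delta>1_def using C1 c by (subst powr_mult) (auto simp: powr_powr)
      finally have "\<epsilon> * cmod w \<le> (C1 / c) powr (1 / real (Suc d)) * \<epsilon> powr \<delta>1" .
      then have "prob {x - \<epsilon>..x + \<epsilon>} \<le> A * \<epsilon> powr \<delta>1"
        using interval_le_cauchy_transform[OF \<epsilon>(1), of x] unfolding A_def w_def by simp
      also have "\<dots> \<le> (A + C2) * \<epsilon> powr \<delta>" using C2 by (intro mono) (auto simp: \<delta>_def)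
      finally show ?thesis .
    next
      case False
      then obtain b where b: "b \<in> B" "\<bar>x - b\<bar> < D" by force
      have "prob {x - \<epsilon>..x + \<epsilon>} \<le> prob {b - 2 * D..b + 2 * D}"
        using b D by (intro finite_measure_mono) auto
      also have "\<dots> \<le> C2 * D powr \<delta>2" using nearB b D by blast
      also have "\<dots> = C2 * \<epsilon> powr (\<theta> * \<delta>2)" unfolding D_def by (simp add: powr_powr)
      also have "\<dots> \<le> (A + C2) * \<epsilon> powr \<delta>" using A by (intro mono) (auto simp: \<delta>_def)
      finally show ?thesis .
    qed
  qed
qed

section \<open>Logarithmic energy\<close>

text \<open>
  For \<open>0 < |u| < 1\<close> and \<open>v = - ln |u|\<close>, exactly the terms with \<open>n \<le> v\<close> are \<open>1\<close>, and there are more than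
  \<open>v\<close> of them.  For \<open>u = 0\<close> both sides are infinite.
\<close>

lemma neg_log_abs_le_suminf:
  "e2ennreal (- log_abs u) \<le> (\<Sum>n. indicator {u. \<bar>u\<bar> \<le> exp (- real n)} u)"
proof -
  define S :: ennreal where "S = (\<Sum>n. indicator {u. \<bar>u\<bar> \<le> exp (- real n)} u)"
  have le: "of_nat N \<le> S" if "\<And>n. n < N \<Longrightarrow> \<bar>u\<bar> \<le> exp (- real n)" for N
  proof -
    have "(of_nat N :: ennreal) = (\<Sum>n<N. indicator {u. \<bar>u\<bar> \<le> exp (- real n)} u)"
      using that by simp
    also have "\<dots> \<le> S" unfolding S_def by (intro sum_le_suminf) auto
    finally show ?thesis .
  qed
  have "e2ennreal (- log_abs u) \<le> S"
  proof (cases "u = 0")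
    case True
    then have "\<And>N. of_nat N \<le> S" by (intro le) simp
    then have "S = top"
      by (metis ennreal_Ex_less_of_nat linorder_not_less order_less_imp_le top.not_eq_extremum)
    then show ?thesis by simp
  next
    case False
    define v where "v = - ln \<bar>u\<bar>"
    have eq: "e2ennreal (- log_abs u) = ennreal v"
      unfolding log_abs_def v_def using False by (simp add: ennreal_def)
    have "of_nat (nat \<lceil>v\<rceil>) \<le> S"
    proof (rule le)
      fix n assume "n < nat \<lceil>v\<rceil>"
      then have "real n < v" by linarith
      then have "exp (ln \<bar>u\<bar>) \<le> exp (- real n)" unfolding v_def by simp
      then show "\<bar>u\<bar> \<le> exp (- real n)" using False by simp
    qed
    then show ?thesis
      unfolding eq by (rule order_trans[rotated])
        (simp add: ennreal_of_nat_eq_real_of_nat ennreal_leI real_nat_ceiling_ge)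
  qed
  then show ?thesis unfolding S_def .
qed

text \<open>
  By \<open>neg_log_abs_le_suminf\<close> the energy is at most the sum over \<open>n\<close> of the masses that the product measure gives
  to \<open>|s - t| \<le> exp (- n)\<close>; a Holder bound makes this a convergent geometric series.
\<close>

lemma (in real_distribution) log_energy_finite:
  assumes supp: "AE x in M. \<bar>x\<bar> \<le> \<rho>" and "C \<ge> 0" "\<delta> > 0"
    and holder: "\<And>x \<epsilon>. \<bar>x\<bar> \<le> \<rho> \<Longrightarrow> 0 < \<epsilon> \<Longrightarrow> \<epsilon> \<le> 1 \<Longrightarrow> prob {x - \<epsilon>..x + \<epsilon>} \<le> C * \<epsilon> powr \<delta>"
  shows "(\<integral>\<^sup>+ (s, t). e2ennreal (- log_abs (s - t)) \<partial>(M \<Otimes>\<^sub>M M)) < \<infinity>"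
proof -
  define E where "E n = {u :: real. \<bar>u\<bar> \<le> exp (- real n)}" for n
  have E[measurable]: "E n \<in> sets borel" for n
    unfolding E_def by measurable
  have "(\<integral>\<^sup>+ (s, t). e2ennreal (- log_abs (s - t)) \<partial>(M \<Otimes>\<^sub>M M))
      \<le> (\<integral>\<^sup>+ x. (\<Sum>n. indicator (E n) (fst x - snd x)) \<partial>(M \<Otimes>\<^sub>M M))"
    unfolding E_def by (intro nn_integral_mono) (auto simp: neg_log_abs_le_suminf split: prod.split)
  also have "\<dots> = (\<Sum>n. \<integral>\<^sup>+ x. indicator (E n) (fst x - snd x) \<partial>(M \<Otimes>\<^sub>M M))"
    by (intro nn_integral_suminf) measurable
  also have "\<dots> \<le> (\<Sum>n. ennreal (C * exp (- \<delta>) ^ n))"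
  proof (rule suminf_le)
    fix n
    have "(\<integral>\<^sup>+ x. indicator (E n) (fst x - snd x) \<partial>(M \<Otimes>\<^sub>M M))
        = (\<integral>\<^sup>+ s. \<integral>\<^sup>+ t. indicator (E n) (s - t) \<partial>M \<partial>M)"
      by (subst nn_integral_fst[symmetric]) auto
    also have "\<dots> \<le> (\<integral>\<^sup>+ s. ennreal (C * exp (- \<delta>) ^ n) \<partial>M)"
    proof (rule nn_integral_mono_AE, use supp in eventually_elim)
      fix s :: real assume s: "\<bar>s\<bar> \<le> \<rho>"
      have "(\<integral>\<^sup>+ t. indicator (E n) (s - t) \<partial>M)
          = (\<integral>\<^sup>+ t. indicator {s - exp (- real n)..s + exp (- real n)} t \<partial>M)"
        by (intro nn_integral_cong) (auto simp: E_def indicator_def abs_le_iff)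
      also have "\<dots> = ennreal (prob {s - exp (- real n)..s + exp (- real n)})"
        by (simp add: emeasure_eq_measure)
      also have "\<dots> \<le> ennreal (C * exp (- real n) powr \<delta>)"
        using s by (intro ennreal_leI holder) auto
      also have "exp (- real n) powr \<delta> = exp (- \<delta>) ^ n"
        by (simp add: powr_def exp_of_nat_mult[symmetric] mult_ac)
      finally show "(\<integral>\<^sup>+ t. indicator (E n) (s - t) \<partial>M) \<le> ennreal (C * exp (- \<delta>) ^ n)" .
    qed
    also have "\<dots> = ennreal (C * exp (- \<delta>) ^ n)" using emeasure_space_1 by simp
    finally show "(\<integral>\<^sup>+ x. indicator (E n) (fst x - snd x) \<partial>(M \<Otimes>\<^sub>M M))
        \<le> ennreal (C * exp (- \<delta>) ^ n)" .
  qed auto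
  also have "\<dots> = ennreal (\<Sum>n. C * exp (- \<delta>) ^ n)"
    using assms by (intro suminf_ennreal2 summable_mult summable_geometric) auto
  also have "\<dots> < \<infinity>" by simp
  finally show ?thesis .
qed

section \<open>The moment problem on a bounded interval\<close>

text \<open>
  Bernstein's operator with nodes weighted by falling factorials instead of powers reproduces \<open>X^j\<close>
  exactly, because \<open>(n choose k) (k choose j) = (n choose j) ((n - j) choose (k - j))\<close>.
\<close>

lemma bernstein_falling_factorial:
  fixes X Y :: "'a::comm_ring_1"
  assumes "X + Y = 1" "j \<le> n"
  shows "(\<Sum>k\<le>n. of_nat ((n choose k) * (k choose j)) * (X ^ k * Y ^ (n - k)))
    = of_nat (n choose j) * X ^ j"
proof -
  have "(\<Sum>k\<le>n. of_nat ((n choose k) * (k choose j)) * (X ^ k * Y ^ (n - k)))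
      = (\<Sum>k\<in>{j..n}. of_nat ((n choose k) * (k choose j)) * (X ^ k * Y ^ (n - k)))"
    by (intro sum.mono_neutral_right) (auto simp: binomial_eq_0)
  also have "\<dots> = (\<Sum>l\<le>n - j. of_nat ((n choose (l + j)) * ((l + j) choose j)) * (X ^ (l + j) * Y ^ (n - (l + j))))"
    using assms(2)
    by (intro sum.reindex_bij_witness[of _ "\<lambda>l. l + j" "\<lambda>k. k - j"]) auto
  also have "\<dots> = (\<Sum>l\<le>n - j. (of_nat (n choose j) * X ^ j) *
      (of_nat ((n - j) choose l) * X ^ l * Y ^ (n - j - l)))"
  proof (rule sum.cong[OF refl])
    fix l assume "l \<in> {..n - j}"
    then have "(n choose (l + j)) * ((l + j) choose j) = (n choose j) * ((n - j) choose l)"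
      using choose_mult[of j "l + j" n] assms(2) by simp
    then have "(of_nat ((n choose (l + j)) * ((l + j) choose j)) :: 'a)
        = of_nat (n choose j) * of_nat ((n - j) choose l)"
      by (simp only: of_nat_mult)
    moreover have "n - (l + j) = n - j - l" by simp
    ultimately show "of_nat ((n choose (l + j)) * ((l + j) choose j)) * (X ^ (l + j) * Y ^ (n - (l + j)))
        = (of_nat (n choose j) * X ^ j) * (of_nat ((n - j) choose l) * X ^ l * Y ^ (n - j - l))"
      by (simp only: power_add mult_ac)
  qed
  also have "\<dots> = of_nat (n choose j) * X ^ j * (X + Y) ^ (n - j)"
    by (simp only: binomial_ring sum_distrib_left)
  finally show ?thesis using assms(1) by simp
qed

lemma falling_factorial_ratio:
  assumes "j \<le> n"
  shows "real (k choose j) / real (n choose j) = (\<Prod>i<j. (real k - real i) / (real n - real i))"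
proof -
  have "real (m choose j) = (\<Prod>i<j. real m - real i) / fact j" for m
    unfolding binomial_gbinomial gbinomial_prod_rev by (simp add: atLeast0LessThan)
  then show ?thesis by (simp add: prod_dividef)
qed

text \<open>
  Both sides are products of \<open>j\<close> factors of absolute value at most \<open>1\<close>, and corresponding factors differ
  by \<open>i (n - k) / (n (n - i))\<close>.
\<close>

lemma falling_factorial_approx:
  assumes "2 * j \<le> n" "0 < n" "k \<le> n"
  shows "\<bar>(real k / real n) ^ j - (\<Prod>i<j. (real k - real i) / (real n - real i))\<bar>
    \<le> real j * (2 * real j / real n)"
proof -
  have bounds: "\<bar>(real k - real i) / (real n - real i)\<bar> \<le> 1"
    "\<bar>real k / real n - (real k - real i) / (real n - real i)\<bar> \<le> 2 * real j / real n"
    if "i < j" for i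
  proof -
    have pos: "real n - real i > 0" using that assms by simp
    have "\<bar>real k - real i\<bar> \<le> real n - real i" using that assms by simp
    then show "\<bar>(real k - real i) / (real n - real i)\<bar> \<le> 1"
      using pos by (simp add: abs_divide)
    have "real k / real n - (real k - real i) / (real n - real i)
        = real i * (real n - real k) / (real n * (real n - real i))"
      using pos assms by (simp add: field_simps)
    moreover have "0 \<le> real i * (real n - real k) / (real n * (real n - real i))"
      using pos assms by (intro divide_nonneg_nonneg mult_nonneg_nonneg) auto
    moreover have "real i * (real n - real k) / (real n * (real n - real i))
        \<le> real j * real n / (real n * (real n / 2))"
      using pos assms that by (intro frac_le mult_mono mult_left_mono mult_pos_pos) auto
    moreover have "real j * real n / (real n * (real n / 2)) = 2 * real j / real n"
      using assms by (simp add: field_simps)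
    ultimately show "\<bar>real k / real n - (real k - real i) / (real n - real i)\<bar> \<le> 2 * real j / real n"
      by (simp only: abs_of_nonneg)
  qed
  have "\<bar>(real k / real n) ^ j - (\<Prod>i<j. (real k - real i) / (real n - real i))\<bar>
      = norm ((\<Prod>i<j. real k / real n) - (\<Prod>i<j. (real k - real i) / (real n - real i)))"
    by simp
  also have "\<dots> \<le> (\<Sum>i<j. norm (real k / real n - (real k - real i) / (real n - real i)))"
    using bounds(1) assms by (intro norm_prod_diff) auto
  also have "\<dots> \<le> (\<Sum>i<j. 2 * real j / real n)"
    using bounds(2) by (intro sum_mono) auto
  finally show ?thesis by simp
qed

lemma finite_distribution:
  fixes w a :: "nat \<Rightarrow> real"
  assumes "\<And>k. k \<le> n \<Longrightarrow> w k \<ge> 0" "(\<Sum>k\<le>n. w k) = 1"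
  obtains \<mu> where "real_distribution \<mu>"
    "\<And>f :: real \<Rightarrow> real. f \<in> borel_measurable borel \<Longrightarrow> (LINT t|\<mu>. f t) = (\<Sum>k\<le>n. w k * f (a k))"
proof -
  define P where "P = point_measure {..n} (\<lambda>k. ennreal (w k))"
  interpret P: prob_space P
  proof
    show "emeasure P (space P) = 1"
    proof -
      have "(\<Sum>k\<le>n. ennreal (w k)) = ennreal (\<Sum>k\<le>n. w k)"
        using assms(1) by (intro sum_ennreal) auto
      then show ?thesis
        unfolding P_def space_point_measure using assms(2)
        by (simp add: emeasure_point_measure_finite)
    qed
  qed
  have meas[measurable]: "a \<in> borel_measurable P"
    unfolding P_def by (simp add: measurable_def sets_point_measure space_point_measure)
  show thesis
  proof
    show "real_distribution (distr P borel a)" by simp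
    fix f :: "real \<Rightarrow> real" assume [measurable]: "f \<in> borel_measurable borel"
    have "(LINT t|distr P borel a. f t) = (LINT k|P. f (a k))"
      by (rule integral_distr) measurable
    also have "\<dots> = (\<Sum>k\<le>n. w k *\<^sub>R f (a k))"
      unfolding P_def using assms by (intro lebesgue_integral_point_measure_finite) auto
    finally show "(LINT t|distr P borel a. f t) = (\<Sum>k\<le>n. w k * f (a k))" by simp
  qed
qed

text \<open>
  The functional is represented approximately by the measure on \<open>{0, 1/n, ..., 1}\<close> whose mass at
  \<open>k/n\<close> is the value of \<open>L\<close> at the Bernstein polynomial \<open>(n choose k) X^k (1 - X)^(n - k)\<close>, which is
  nonnegative by assumption.  Its moments converge to those of \<open>L\<close>, and Helly's selection theorem
  provides a weak limit.
\<close>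

lemma hausdorff_moment_problem:
  fixes L :: "real poly \<Rightarrow> real"
  assumes add: "\<And>p q. L (p + q) = L p + L q"
    and smult: "\<And>c p. L (smult c p) = c * L p"
    and one: "L 1 = 1"
    and pos: "\<And>k l. 0 \<le> L ([:0, 1:] ^ k * [:1, -1:] ^ l)"
  obtains \<nu> where "real_distribution \<nu>" "AE t in \<nu>. 0 \<le> t \<and> t \<le> 1"
    "\<And>p. (LINT t|\<nu>. poly p t) = L p"
proof -
  define X :: "real poly" where "X = [:0, 1:]"
  define Y :: "real poly" where "Y = [:1, -1:]"
  have XY: "X + Y = 1" unfolding X_def Y_def by simp
  have L0: "L 0 = 0" using smult[of 0 0] by simp
  have L_sum: "L (\<Sum>i\<in>I. f i) = (\<Sum>i\<in>I. L (f i))" for I :: "nat set" and f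
    by (induction I rule: infinite_finite_induct) (auto simp: L0 add)
  have L_of_nat: "L (of_nat c * p) = real c * L p" for c p
    by (simp add: of_nat_poly smult)
  define w where "w n k = real (n choose k) * L (X ^ k * Y ^ (n - k))" for n k
  have w_nonneg: "0 \<le> w n k" for n k
    unfolding w_def X_def Y_def using pos by simp
  have w_moment: "(\<Sum>k\<le>n. w n k * (real (k choose j) / real (n choose j))) = L (X ^ j)"
    if "j \<le> n" for n j
  proof -
    have "real (n choose j) * L (X ^ j)
        = L (\<Sum>k\<le>n. of_nat ((n choose k) * (k choose j)) * (X ^ k * Y ^ (n - k)))"
      unfolding bernstein_falling_factorial[OF XY that] L_of_nat ..
    also have "\<dots> = (\<Sum>k\<le>n. w n k * real (k choose j))"
      unfolding L_sum L_of_nat w_def by (simp add: mult_ac)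
    finally show ?thesis
      using that by (simp add: sum_divide_distrib[symmetric] field_simps)
  qed
  have w_sum: "(\<Sum>k\<le>n. w n k) = 1" for n
    using w_moment[of 0 n] one by simp
  have "\<exists>\<mu>. real_distribution \<mu> \<and> (\<forall>f :: real \<Rightarrow> real. f \<in> borel_measurable borel \<longrightarrow>
      (LINT t|\<mu>. f t) = (\<Sum>k\<le>n. w n k * f (real k / real n)))" for n
    using finite_distribution[of n "w n" "\<lambda>k. real k / real n"] w_nonneg w_sum by metis
  then obtain \<mu> where \<mu>: "\<And>n. real_distribution (\<mu> n)"
    and int_\<mu>: "\<And>n f. f \<in> borel_measurable borel \<Longrightarrow>
      (LINT t|\<mu> n. f t :: real) = (\<Sum>k\<le>n. w n k * f (real k / real n))"
    by metis
  have frac: "0 \<le> real k / real n \<and> real k / real n \<le> 1" if "k \<le> n" for k n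
    using that by (cases "n = 0") (auto simp: field_simps)
  have "tight \<mu>"
    unfolding tight_def
  proof (intro conjI allI impI \<mu>)
    fix \<epsilon> :: real assume "\<epsilon> > 0"
    have "measure (\<mu> n) {-1<..1} = 1" for n
    proof -
      interpret real_distribution "\<mu> n" by (rule \<mu>)
      have "measure (\<mu> n) {-1<..1} = (LINT t|\<mu> n. indicator {-1<..1} t)" by simp
      also have "\<dots> = (\<Sum>k\<le>n. w n k * indicator {-1<..1} (real k / real n))"
        by (rule int_\<mu>) simp
      also have "\<dots> = (\<Sum>k\<le>n. w n k * 1)"
      proof (intro sum.cong refl)
        fix k assume "k \<in> {..n}"
        then have "0 \<le> real k / real n" "real k / real n \<le> 1" using frac[of k n] by blast+
          then have "real k / real n \<in> {-1<..1}" unfolding greaterThanAtMost_iff by linarith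
        then show "w n k * indicator {-1<..1} (real k / real n) = w n k * 1" by simp
      qed
      finally show ?thesis using w_sum by simp
    qed
    then show "\<exists>a b. a < b \<and> (\<forall>n. 1 - \<epsilon> < measure (\<mu> n) {a<..b})"
      using \<open>\<epsilon> > 0\<close> by (intro exI[of _ "-1"] exI[of _ 1]) simp
  qed
  then obtain r \<nu> where r: "strict_mono r" and \<nu>: "real_distribution \<nu>"
    and weak: "weak_conv_m (\<mu> \<circ> id \<circ> r) \<nu>"
    using tight_imp_convergent_subsubsequence[of \<mu> id] strict_mono_id by blast
  interpret \<nu>: real_distribution \<nu> by (rule \<nu>)
  have conv: "(\<lambda>n. \<Sum>k\<le>r n. w (r n) k * f (real k / real (r n))) \<longlonglongrightarrow> (LINT t|\<nu>. f t)"
    if f: "\<And>x. isCont f x" "\<And>x. norm (f x) \<le> B" for f :: "real \<Rightarrow> real" and B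
  proof -
    have "(\<lambda>n. LINT t|(\<mu> \<circ> id \<circ> r) n. f t) \<longlonglongrightarrow> (LINT t|\<nu>. f t)"
      by (rule weak_conv_imp_integral_bdd_continuous_conv[OF _ \<nu> weak])
        (use \<mu> f in auto)
    moreover have "f \<in> borel_measurable borel"
      using f(1) by (intro borel_measurable_continuous_onI continuous_at_imp_continuous_on) auto
    ultimately show ?thesis by (simp add: int_\<mu>)
  qed
  \<comment> \<open>Weak convergence tests bounded functions only, so \<open>t\<close> is truncated to the unit interval, which
    changes nothing at the nodes \<open>k/n\<close>.\<close>
  define c where "c t = max 0 (min 1 t)" for t :: real
  have c_cont: "isCont c x" for x
    unfolding c_def by (intro continuous_intros)
  have c_frac: "c (real k / real n) = real k / real n" if "k \<le> n" for k n
    unfolding c_def using frac[OF that] by simp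
  have c_bd: "0 \<le> c t" "c t \<le> 1" for t unfolding c_def by auto
  define g where "g t = min 1 \<bar>t - c t\<bar>" for t
  have g_cont: "isCont g x" for x
    unfolding g_def by (intro continuous_intros c_cont)
  have g_bd: "norm (g t) \<le> 1" for t unfolding g_def by auto
  have g_meas: "g \<in> borel_measurable borel"
    using g_cont by (intro borel_measurable_continuous_onI continuous_at_imp_continuous_on) auto
  have "(\<lambda>n. \<Sum>k\<le>r n. w (r n) k * g (real k / real (r n))) \<longlonglongrightarrow> (LINT t|\<nu>. g t)"
    using g_cont g_bd by (rule conv)
  moreover have "(\<lambda>n. \<Sum>k\<le>r n. w (r n) k * g (real k / real (r n))) = (\<lambda>n. 0)"
    by (auto simp: g_def c_frac intro!: sum.neutral)
  ultimately have g0: "(LINT t|\<nu>. g t) = 0"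
    by (simp add: LIMSEQ_const_iff)
  have "integrable \<nu> g"
    using g_bd g_meas by (intro \<nu>.integrable_const_bound[where B = 1]) auto
  then have "AE t in \<nu>. g t = 0"
    using g0 by (subst (asm) integral_nonneg_eq_0_iff_AE) (auto simp: g_def)
  then have supp: "AE t in \<nu>. t = c t"
    by eventually_elim (auto simp: g_def min_def split: if_splits)
  have moment: "(LINT t|\<nu>. t ^ j) = L (X ^ j)" for j
  proof -
    have "(\<lambda>n. \<Sum>k\<le>r n. w (r n) k * c (real k / real (r n)) ^ j) \<longlonglongrightarrow> (LINT t|\<nu>. c t ^ j)"
    proof (rule conv)
      show "isCont (\<lambda>t. c t ^ j) t" for t
        using c_cont by (rule isCont_power)
      show "norm (c t ^ j) \<le> 1" for t
        using c_bd[of t] by (simp add: power_le_one)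
    qed
    moreover have "(\<lambda>n. \<Sum>k\<le>r n. w (r n) k * c (real k / real (r n)) ^ j) \<longlonglongrightarrow> L (X ^ j)"
    proof (rule LIM_zero_cancel, rule Lim_null_comparison)
      have "eventually (\<lambda>n. 2 * j + 1 \<le> n) sequentially" by (rule eventually_ge_at_top)
      then show "eventually (\<lambda>n. norm ((\<Sum>k\<le>r n. w (r n) k * c (real k / real (r n)) ^ j) - L (X ^ j))
          \<le> real j * (2 * real j) * inverse (real (r n))) sequentially"
      proof eventually_elim
        fix n assume n: "2 * j + 1 \<le> n"
        define N where "N = r n"
        have N: "2 * j + 1 \<le> N" using n strict_mono_imp_increasing[OF r, of n] by (simp add: N_def)
        have "(\<Sum>k\<le>N. w N k * c (real k / real N) ^ j) - L (X ^ j)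
            = (\<Sum>k\<le>N. w N k * ((real k / real N) ^ j - (\<Prod>i<j. (real k - real i) / (real N - real i))))"
          using w_moment[of j N] N
          by (simp add: falling_factorial_ratio c_frac right_diff_distrib sum_subtractf)
        also have "norm \<dots> \<le> (\<Sum>k\<le>N. w N k * (real j * (2 * real j / real N)))"
        proof (rule sum_norm_le)
          fix k assume "k \<in> {..N}"
          then have "\<bar>(real k / real N) ^ j - (\<Prod>i<j. (real k - real i) / (real N - real i))\<bar>
              \<le> real j * (2 * real j / real N)"
            using N by (intro falling_factorial_approx) auto
          then show "norm (w N k * ((real k / real N) ^ j - (\<Prod>i<j. (real k - real i) / (real N - real i))))
              \<le> w N k * (real j * (2 * real j / real N))"
            unfolding real_norm_def abs_mult abs_of_nonneg[OF w_nonneg]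
            by (rule mult_left_mono) (rule w_nonneg)
        qed
        also have "\<dots> = real j * (2 * real j) * inverse (real N)"
          unfolding sum_distrib_right[symmetric] w_sum by (simp add: divide_inverse)
        finally show "norm ((\<Sum>k\<le>r n. w (r n) k * c (real k / real (r n)) ^ j) - L (X ^ j))
            \<le> real j * (2 * real j) * inverse (real (r n))" unfolding N_def .
      qed
      have "(\<lambda>n. inverse (real (r n))) \<longlonglongrightarrow> 0"
        using LIMSEQ_subseq_LIMSEQ[OF lim_inverse_n r] by (simp add: o_def)
      then show "(\<lambda>n. real j * (2 * real j) * inverse (real (r n))) \<longlonglongrightarrow> 0"
        by (rule tendsto_mult_right_zero)
    qed
    ultimately have "(LINT t|\<nu>. c t ^ j) = L (X ^ j)" by (rule LIMSEQ_unique)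
    moreover have "(LINT t|\<nu>. t ^ j) = (LINT t|\<nu>. c t ^ j)"
    proof (rule integral_cong_AE)
      show "AE t in \<nu>. t ^ j = c t ^ j" using supp by eventually_elim simp
      show "(\<lambda>t. c t ^ j) \<in> borel_measurable \<nu>" unfolding c_def by measurable
    qed simp
    ultimately show ?thesis by simp
  qed
  have bound: "AE t in \<nu>. 0 \<le> t \<and> t \<le> 1"
    using supp by eventually_elim (metis c_bd)
  have int_pow: "integrable \<nu> (\<lambda>t. t ^ j)" for j
  proof (rule \<nu>.integrable_const_bound[where B = 1])
    show "AE t in \<nu>. norm (t ^ j) \<le> 1"
      using bound by eventually_elim (simp add: power_le_one)
  qed simp
  show thesis
  proof
    fix p
    have "L p = L (\<Sum>i\<le>degree p. smult (coeff p i) (X ^ i))"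
      unfolding X_def by (simp only: poly_as_sum_of_monoms flip: monom_altdef)
    also have "\<dots> = (\<Sum>i\<le>degree p. coeff p i * (LINT t|\<nu>. t ^ i))"
      by (simp only: L_sum smult moment)
    also have "\<dots> = (LINT t|\<nu>. poly p t)"
      unfolding poly_altdef using int_pow by simp
    finally show "(LINT t|\<nu>. poly p t) = L p" ..
  qed (fact \<nu> bound)+
qed

text \<open>
  For bounded support the characteristic function is the sum of its power series, whose coefficients
  are the moments.
\<close>

lemma moments_determine_distribution:
  assumes "real_distribution \<mu>" "real_distribution \<nu>"
    and "AE t in \<mu>. \<bar>t\<bar> \<le> \<rho>" "AE t in \<nu>. \<bar>t\<bar> \<le> \<rho>"
    and moments: "\<And>k. (LINT t|\<mu>. t ^ k) = (LINT t|\<nu>. t ^ k)"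
  shows "\<mu> = \<nu>"
proof (rule Levy_uniqueness[OF assms(1,2)])
  have conv: "(\<lambda>n. \<Sum>k\<le>n. (\<i> * of_real s) ^ k / fact k * of_real (LINT t|\<kappa>. t ^ k)) \<longlonglongrightarrow> char \<kappa> s"
    if "real_distribution \<kappa>" and bound: "AE t in \<kappa>. \<bar>t\<bar> \<le> \<rho>" for \<kappa> s
  proof -
    interpret real_distribution \<kappa> by fact
    have "0 \<le> \<rho>"
    proof (rule ccontr)
      assume "\<not> 0 \<le> \<rho>"
      have "AE t in \<kappa>. False"
        using bound by eventually_elim (use \<open>\<not> 0 \<le> \<rho>\<close> in auto)
      then show False by simp
    qed
    have pow: "AE t in \<kappa>. \<bar>t ^ k\<bar> \<le> \<rho> ^ k" for k
      using bound by eventually_elim (simp add: power_abs power_mono)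
    have int: "integrable \<kappa> (\<lambda>t. t ^ k)" for k
      by (rule integrable_const_bound[where B = "\<rho> ^ k"]) (use pow in auto)
    define S where "S n = (\<Sum>k\<le>n. (\<i> * of_real s) ^ k / fact k * of_real (LINT t|\<kappa>. t ^ k))" for n
    have "norm (S n - char \<kappa> s) \<le> 2 * (inverse (fact n) * (\<bar>s\<bar> * \<rho>) ^ n)" for n
    proof -
      have "integrable \<kappa> (\<lambda>t. \<bar>t\<bar> ^ n)"
        using integrable_norm[OF int[of n]] by (simp add: power_abs)
      moreover have "AE t in \<kappa>. \<bar>t\<bar> ^ n \<le> \<rho> ^ n"
        using pow[of n] by (simp add: power_abs)
      ultimately have "expectation (\<lambda>t. \<bar>t\<bar> ^ n) \<le> expectation (\<lambda>t. \<rho> ^ n)"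
        by (intro integral_mono_AE) simp_all
      then have "expectation (\<lambda>t. \<bar>t\<bar> ^ n) \<le> \<rho> ^ n" using prob_space by simp
      then have "2 * \<bar>s\<bar> ^ n / fact n * expectation (\<lambda>t. \<bar>t\<bar> ^ n) \<le> 2 * \<bar>s\<bar> ^ n / fact n * \<rho> ^ n"
        by (intro mult_left_mono) auto
      also have "\<dots> = 2 * (inverse (fact n) * (\<bar>s\<bar> * \<rho>) ^ n)"
        by (simp add: power_mult_distrib divide_inverse)
      finally have "2 * \<bar>s\<bar> ^ n / fact n * expectation (\<lambda>t. \<bar>t\<bar> ^ n)
          \<le> 2 * (inverse (fact n) * (\<bar>s\<bar> * \<rho>) ^ n)" .
      then show ?thesis
        unfolding S_def norm_minus_commute[of _ "char \<kappa> s"]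
        by (rule order_trans[OF char_approx1[OF int]])
    qed
    moreover have "(\<lambda>n. 2 * (inverse (fact n) * (\<bar>s\<bar> * \<rho>) ^ n)) \<longlonglongrightarrow> 0"
      by (rule tendsto_mult_right_zero[OF summable_LIMSEQ_zero[OF summable_exp]])
    ultimately have "(\<lambda>n. S n - char \<kappa> s) \<longlonglongrightarrow> 0"
      by (rule Lim_null_comparison[OF always_eventually[OF allI]])
    then show ?thesis unfolding S_def by (rule LIM_zero_cancel)
  qed
  show "char \<mu> = char \<nu>"
  proof
    fix s
    show "char \<mu> s = char \<nu> s"
      using conv[OF assms(1,3), of s] conv[OF assms(2,4), of s]
      unfolding moments by (rule LIMSEQ_unique)
  qed
qed

section \<open>Polynomials in a self-adjoint operator\<close>

text \<open>
  The operator \<open>p(T)\<close> in Horner form, so that its properties follow by induction over the coefficients.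
\<close>

definition op_poly :: "('h::complex_hilbert_space \<Rightarrow>\<^sub>L 'h) \<Rightarrow> real poly \<Rightarrow> ('h \<Rightarrow>\<^sub>L 'h)" where
  "op_poly T p = fold_coeffs (\<lambda>a S. a *\<^sub>R id_blinfun + (T o\<^sub>L S)) p 0"

lemma op_poly_0: "op_poly T 0 = 0"
  by (simp add: op_poly_def)

lemma op_poly_pCons: "op_poly T (pCons a p) = a *\<^sub>R id_blinfun + (T o\<^sub>L op_poly T p)"
  by (cases "a = 0 \<and> p = 0") (auto simp: op_poly_def)

lemma op_poly_apply_pCons: "op_poly T (pCons a p) x = a *\<^sub>R x + T (op_poly T p x)"
  by (simp add: op_poly_pCons blinfun.bilinear_simps)

lemma op_poly_add: "op_poly T (p + q) = op_poly T p + op_poly T q"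
  by (rule blinfun_eqI, induction p q rule: poly_induct2)
    (simp_all add: op_poly_0 op_poly_apply_pCons blinfun.bilinear_simps algebra_simps)

lemma op_poly_smult: "op_poly T (smult c p) = c *\<^sub>R op_poly T p"
  by (rule blinfun_eqI, induction p)
    (simp_all add: op_poly_0 op_poly_apply_pCons blinfun.bilinear_simps algebra_simps)

lemma op_poly_mult: "op_poly T (p * q) = op_poly T p o\<^sub>L op_poly T q"
  by (rule blinfun_eqI, induction p)
    (simp_all add: op_poly_0 op_poly_apply_pCons op_poly_add op_poly_smult blinfun.bilinear_simps)

lemma op_poly_const: "op_poly T [:c:] = c *\<^sub>R id_blinfun"
  by (rule blinfun_eqI) (simp add: op_poly_apply_pCons op_poly_0 blinfun.bilinear_simps)

lemma op_poly_power: "op_poly T ([:0, 1:] ^ k) = op_power T k"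
proof (induction k)
  case 0
  show ?case using op_poly_const[of T 1] by (simp add: one_pCons)
next
  case (Suc k)
  then show ?case
    by (intro blinfun_eqI) (simp add: op_poly_apply_pCons blinfun.bilinear_simps)
qed

lemma cinner_add_left: "cinner (x + y) z = cinner x z + cinner y z"
  by (metis cinner_add_right cinner_commute complex_cnj_add)

lemma cinner_scaleR_right: "cinner x (r *\<^sub>R y) = of_real r * cinner x y"
  by (metis cinner_scaleC_right scaleC_of_real)

lemma cinner_scaleR_left: "cinner (r *\<^sub>R x) y = of_real r * cinner x y"
  by (metis cinner_commute cinner_scaleR_right complex_cnj_complex_of_real complex_cnj_mult)

lemma cinner_zero: "cinner x 0 = 0" "cinner 0 x = 0"
  using cinner_scaleR_right[of x 0 0] cinner_scaleR_left[of 0 0 x] by simp_all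

lemma op_poly_commute: "op_poly T p (T x) = T (op_poly T p x)"
proof -
  have "op_poly T (p * [:0, 1:]) x = op_poly T ([:0, 1:] * p) x"
    by (simp only: mult.commute)
  then show ?thesis
    by (simp add: op_poly_mult op_poly_apply_pCons op_poly_0 blinfun.bilinear_simps
        del: mult_pCons_left mult_pCons_right)
qed

lemma self_adjoint_op_poly:
  assumes "self_adjoint T"
  shows "self_adjoint (op_poly T p)"
proof -
  have "cinner (op_poly T p x) y = cinner x (op_poly T p y)" for x y
  proof (induction p arbitrary: x y)
    case 0
    show ?case by (simp add: op_poly_0 cinner_zero)
  next
    case (pCons a p)
    have "cinner (T (op_poly T p x)) y = cinner x (T (op_poly T p y))"
      using assms pCons.IH[of x "T y"] unfolding self_adjoint_def is_adjoint_def
      by (simp add: op_poly_commute)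
    then show ?case
      by (simp add: op_poly_apply_pCons cinner_add_left cinner_add_right
          cinner_scaleR_left cinner_scaleR_right)
  qed
  then show ?thesis by (simp add: self_adjoint_def is_adjoint_def)
qed

lemma positive_op_self_adjoint:
  assumes "self_adjoint T" "\<And>x. 0 \<le> inner x (T x)"
  shows "positive_op T"
  unfolding positive_op_def
proof
  fix x
  have "cnj (cinner x (T x)) = cinner x (T x)"
    using assms(1) unfolding self_adjoint_def is_adjoint_def by (metis cinner_commute)
  then have "cinner x (T x) \<in> \<real>" by (simp add: Reals_cnj_iff)
  then show "cinner x (T x) \<in> \<real>\<^sub>\<ge>\<^sub>0"
    using assms(2)[of x] by (simp add: complex_nonneg_Reals_iff complex_is_Real_iff inner_eq_Re_cinner)
qed

definition op_nonneg_poly :: "('h::complex_hilbert_space \<Rightarrow>\<^sub>L 'h) \<Rightarrow> real poly \<Rightarrow> bool" where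
  "op_nonneg_poly T p \<longleftrightarrow> (\<forall>x. 0 \<le> inner x (op_poly T p x))"

lemma op_nonneg_add: "op_nonneg_poly T p \<Longrightarrow> op_nonneg_poly T q \<Longrightarrow> op_nonneg_poly T (p + q)"
  by (simp add: op_nonneg_poly_def op_poly_add blinfun.bilinear_simps inner_add_right)

lemma op_nonneg_smult: "0 \<le> c \<Longrightarrow> op_nonneg_poly T p \<Longrightarrow> op_nonneg_poly T (smult c p)"
  by (simp add: op_nonneg_poly_def op_poly_smult blinfun.bilinear_simps)

lemma op_nonneg_conjugate:
  assumes "self_adjoint T" "op_nonneg_poly T p"
  shows "op_nonneg_poly T (s * s * p)"
  unfolding op_nonneg_poly_def
proof
  fix x
  have "s * s * p = s * (p * s)" by (simp add: mult_ac)
  then have "op_poly T (s * s * p) x = op_poly T s (op_poly T p (op_poly T s x))"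
    by (simp only: op_poly_mult blinfun_apply_blinfun_compose)
  then have "inner x (op_poly T (s * s * p) x)
      = Re (cinner x (op_poly T s (op_poly T p (op_poly T s x))))"
    by (simp only: inner_eq_Re_cinner)
  also have "\<dots> = inner (op_poly T s x) (op_poly T p (op_poly T s x))"
    using self_adjoint_op_poly[OF assms(1), of s]
    by (simp add: inner_eq_Re_cinner self_adjoint_def is_adjoint_def)
  finally show "0 \<le> inner x (op_poly T (s * s * p) x)"
    using assms(2) by (simp add: op_nonneg_poly_def)
qed

lemma op_nonneg_const_plus:
  assumes "norm (op_poly T p) \<le> c"
  shows "op_nonneg_poly T ([:c:] + p)"
  unfolding op_nonneg_poly_def
proof
  fix x
  have "\<bar>inner x (op_poly T p x)\<bar> \<le> norm x * norm (op_poly T p x)"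
    by (rule Cauchy_Schwarz_ineq2)
  also have "\<dots> \<le> norm x * (norm (op_poly T p) * norm x)"
    by (intro mult_left_mono norm_blinfun) auto
  also have "\<dots> \<le> norm x * (c * norm x)"
    using assms by (intro mult_left_mono mult_right_mono) auto
  also have "\<dots> = c * inner x x"
    by (simp add: power2_norm_eq_inner[symmetric] power2_eq_square)
  finally show "0 \<le> inner x (op_poly T ([:c:] + p) x)"
    by (simp only: op_poly_add op_poly_const blinfun.bilinear_simps inner_add_right)
      (simp add: abs_le_iff)
qed

text \<open>
  Commuting nonnegative operators have a nonnegative product, which for \<open>R + T\<close> and \<open>R - T\<close> can be
  seen without square roots: with
  \<open>u = R + T\<close> and \<open>v = R - T\<close>, even powers are of the form \<open>s p s\<close> with \<open>s\<close> self-adjoint, and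
  \<open>2 R u v = (u + v) u v = u v u + v u v\<close> settles the remaining case of one factor of each.
\<close>

lemma op_nonneg_products:
  assumes "self_adjoint T" "norm T \<le> R" "0 < R"
  shows "op_nonneg_poly T ([:R, 1:] ^ k * [:R, -1:] ^ l)"
proof -
  define u v :: "real poly" where "u = [:R, 1:]" and "v = [:R, -1:]"
  have T: "op_poly T [:0, 1:] = T" "op_poly T [:0, -1:] = - T"
    by (auto intro!: blinfun_eqI simp: op_poly_apply_pCons op_poly_0 blinfun.bilinear_simps)
  have u: "op_nonneg_poly T u"
    using op_nonneg_const_plus[of T "[:0, 1:]" R] T assms(2) by (simp add: u_def)
  have v: "op_nonneg_poly T v"
    using op_nonneg_const_plus[of T "[:0, -1:]" R] T assms(2) by (simp add: v_def)
  have one: "op_nonneg_poly T 1"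
    using op_poly_const[of T 1] by (simp add: op_nonneg_poly_def blinfun.bilinear_simps one_pCons)
  have "u * u * v + v * v * u = (u + v) * (u * v)" by (simp add: algebra_simps)
  also have "u + v = [:2 * R:]" by (simp add: u_def v_def)
  finally have "u * v = smult (1 / (2 * R)) (u * u * v + v * v * u)"
    using assms(3) by simp
  then have uv: "op_nonneg_poly T (u * v)"
    using assms u v by (auto intro!: op_nonneg_smult op_nonneg_add op_nonneg_conjugate)
  have "op_nonneg_poly T (u ^ (k mod 2) * v ^ (l mod 2))"
    using one u v uv by (cases "even k"; cases "even l") (auto simp: even_iff_mod_2_eq_zero odd_iff_mod_2_eq_one)
  then have "op_nonneg_poly T ((u ^ (k div 2) * v ^ (l div 2)) * (u ^ (k div 2) * v ^ (l div 2))
      * (u ^ (k mod 2) * v ^ (l mod 2)))"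
    by (rule op_nonneg_conjugate[OF assms(1)])
  also have "(u ^ (k div 2) * v ^ (l div 2)) * (u ^ (k div 2) * v ^ (l div 2))
      * (u ^ (k mod 2) * v ^ (l mod 2)) = u ^ (k div 2 * 2 + k mod 2) * v ^ (l div 2 * 2 + l mod 2)"
    by (simp only: power_add power_mult power2_eq_square power_mult_distrib mult_ac)
  finally show ?thesis by (simp only: div_mult_mod_eq u_def v_def)
qed

section \<open>The spectral measure\<close>

lemma scaleC_op_of_real: "scaleC_op (of_real r) T = r *\<^sub>R T"
  by (rule blinfun_eqI) (simp add: scaleC_op.rep_eq scaleC_of_real blinfun.bilinear_simps)

context von_neumann_algebra
begin

lemma scaleR_mem: "T \<in> M \<Longrightarrow> r *\<^sub>R T \<in> M"
  by (metis scaleC_mem scaleC_op_of_real)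

lemma op_poly_mem: "T \<in> M \<Longrightarrow> op_poly T p \<in> M"
proof (induction p)
  case 0
  have "0 *\<^sub>R id_blinfun \<in> M" using id_mem by (rule scaleR_mem)
  then show ?case by (simp add: op_poly_0)
next
  case (pCons a p)
  then show ?case
    by (simp add: op_poly_pCons add_mem scaleR_mem id_mem compose_mem)
qed

end

context tracial_von_neumann_algebra
begin

lemma trace_scaleR: "T \<in> M \<Longrightarrow> \<tau> (r *\<^sub>R T) = of_real r * \<tau> T"
  by (metis scaleC_op_of_real trace_scaleC)

lemma trace_op_nonneg_poly:
  assumes "y \<in> M" "self_adjoint y" "op_nonneg_poly y p"
  shows "\<tau> (op_poly y p) \<in> \<real>\<^sub>\<ge>\<^sub>0"
  using assms
  by (intro trace_positive positive_op_self_adjoint self_adjoint_op_poly op_poly_mem)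
    (auto simp: op_nonneg_poly_def)

text \<open>
  Adding a multiple of the identity makes the operator positive.
\<close>

lemma trace_op_poly_real:
  assumes "y \<in> M" "self_adjoint y"
  shows "\<tau> (op_poly y p) \<in> \<real>"
proof -
  define c where "c = norm (op_poly y p)"
  have "\<tau> (op_poly y ([:c:] + p)) \<in> \<real>\<^sub>\<ge>\<^sub>0"
    using assms by (intro trace_op_nonneg_poly op_nonneg_const_plus) (auto simp: c_def)
  moreover have "\<tau> (op_poly y ([:c:] + p)) = of_real c + \<tau> (op_poly y p)"
    using assms
    by (simp only: op_poly_add op_poly_const trace_add trace_scaleR trace_id id_mem scaleR_mem
        op_poly_mem mult_1_right)
  ultimately have "of_real c + \<tau> (op_poly y p) \<in> \<real>" by (simp add: nonneg_Reals_subset_Reals[THEN subsetD])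
  then have "of_real c + \<tau> (op_poly y p) - of_real c \<in> \<real>" by (intro Reals_diff) auto
  then show ?thesis by simp
qed

text \<open>
  The affine substitution \<open>f\<close> maps \<open>[-R, R]\<close> onto \<open>[0, 1]\<close>, where the moment problem for
  \<open>p \<mapsto> \<tau> (p (y))\<close> is solved; positivity on \<open>X^k (1 - X)^l\<close> is that of the products of powers of
  \<open>R + y\<close> and \<open>R - y\<close>.
\<close>

lemma spectral_measure_exists:
  assumes "y \<in> M" "self_adjoint y"
  shows "\<exists>\<mu>. is_spectral_measure \<tau> y \<mu>"
proof -
  define R where "R = norm y + 1"
  have R: "norm y \<le> R" "0 < R" by (auto simp: R_def add_nonneg_pos)
  define f :: "real poly" where "f = [:1 / 2, 1 / (2 * R):]"
  define L where "L p = Re (\<tau> (op_poly y (p \<circ>\<^sub>p f)))" for p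
  have pcompose_power: "(p ^ k) \<circ>\<^sub>p f = (p \<circ>\<^sub>p f) ^ k" for p :: "real poly" and k
    by (induction k) (simp_all add: pcompose_1 pcompose_mult)
  have add: "L (p + q) = L p + L q" for p q
    using assms by (simp add: L_def pcompose_add op_poly_add trace_add op_poly_mem)
  have smult: "L (smult c p) = c * L p" for c p
    using assms by (simp add: L_def pcompose_smult op_poly_smult trace_scaleR op_poly_mem)
  have one: "L 1 = 1"
    using op_poly_const[of y 1] by (simp add: L_def pcompose_1 trace_id one_pCons)
  have pos: "0 \<le> L ([:0, 1:] ^ k * [:1, -1:] ^ l)" for k l
  proof -
    have f: "[:0, 1:] \<circ>\<^sub>p f = smult (1 / (2 * R)) [:R, 1:]" "[:1, -1:] \<circ>\<^sub>p f = smult (1 / (2 * R)) [:R, -1:]"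
      using R by (simp_all add: f_def pcompose_pCons)
    have "([:0, 1:] ^ k * [:1, -1:] ^ l) \<circ>\<^sub>p f
        = smult ((1 / (2 * R)) ^ k * (1 / (2 * R)) ^ l) ([:R, 1:] ^ k * [:R, -1:] ^ l)"
      by (simp only: pcompose_mult pcompose_power f smult_power mult_smult_left mult_smult_right
          smult_smult mult.commute)
    moreover have "op_nonneg_poly y (smult ((1 / (2 * R)) ^ k * (1 / (2 * R)) ^ l) ([:R, 1:] ^ k * [:R, -1:] ^ l))"
      using R by (intro op_nonneg_smult op_nonneg_products assms) auto
    ultimately show ?thesis
      using trace_op_nonneg_poly[OF assms] by (auto simp: L_def complex_nonneg_Reals_iff)
  qed
  obtain \<nu> where \<nu>: "real_distribution \<nu>" and supp: "AE t in \<nu>. 0 \<le> t \<and> t \<le> 1"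
    and L: "\<And>p. (LINT t|\<nu>. poly p t) = L p"
    using hausdorff_moment_problem[of L] add smult one pos by blast
  interpret \<nu>: real_distribution \<nu> by (rule \<nu>)
  define g where "g t = 2 * R * t - R" for t
  have g[measurable]: "g \<in> borel_measurable borel" unfolding g_def by measurable
  define \<mu> where "\<mu> = distr \<nu> borel g"
  have "is_spectral_measure \<tau> y \<mu>"
    unfolding is_spectral_measure_def
  proof (intro conjI allI exI)
    show "real_distribution \<mu>" unfolding \<mu>_def by simp
    show "compact {-R..R}" by simp
    have "AE t in \<nu>. t \<notin> g -` (- {-R..R}) \<inter> space \<nu>"
      using supp
    proof eventually_elim
      fix t :: real assume "0 \<le> t \<and> t \<le> 1"
      then have "0 \<le> R * t" "R * t \<le> R * 1"
        using R by (auto intro!: mult_left_mono simp del: mult_1_right)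
      then show "t \<notin> g -` (- {-R..R}) \<inter> space \<nu>" by (auto simp: g_def)
    qed
    moreover have "g -` (- {-R..R}) \<inter> space \<nu> \<in> sets \<nu>"
      by (rule measurable_sets[of g \<nu> borel]) auto
    ultimately have "emeasure \<nu> (g -` (- {-R..R}) \<inter> space \<nu>) = 0"
      using AE_iff_null_sets by (blast dest: null_setsD1)
    then show "emeasure \<mu> (- {-R..R}) = 0"
      unfolding \<mu>_def by (subst emeasure_distr) auto
    fix k
    have "poly ([:- R, 2 * R:] ^ k) = (\<lambda>t. g t ^ k)"
      by (rule ext) (simp add: g_def poly_power mult.commute)
    then have "(LINT t|\<mu>. t ^ k) = (LINT t|\<nu>. poly ([:- R, 2 * R:] ^ k) t)"
      unfolding \<mu>_def by (simp add: integral_distr)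
    also have "\<dots> = Re (\<tau> (op_poly y ([:0, 1:] ^ k)))"
    proof -
      have "[:- R, 2 * R:] \<circ>\<^sub>p f = [:0, 1:]" using R by (simp add: f_def pcompose_pCons)
      then show ?thesis by (simp only: L L_def pcompose_power)
    qed
    finally have "(LINT t|\<mu>. t ^ k) = Re (\<tau> (op_power y k))" by (simp only: op_poly_power)
    moreover have "\<tau> (op_power y k) \<in> \<real>"
      using trace_op_poly_real[OF assms, of "[:0, 1:] ^ k"] by (simp only: op_poly_power)
    ultimately show "of_real (LINT t|\<mu>. t ^ k) = \<tau> (op_power y k)"
      by (simp add: complex_is_Real_iff complex_eq_iff)
  qed
  then show ?thesis ..
qed

end

lemma is_spectral_measure_bounded:
  assumes "is_spectral_measure \<tau> y \<mu>"
  obtains \<rho> where "AE t in \<mu>. \<bar>t\<bar> \<le> \<rho>"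
proof -
  interpret real_distribution \<mu> using assms by (simp add: is_spectral_measure_def)
  obtain K where K: "compact K" "emeasure \<mu> (- K) = 0"
    using assms by (auto simp: is_spectral_measure_def)
  obtain \<rho> where \<rho>: "\<And>t. t \<in> K \<Longrightarrow> \<bar>t\<bar> \<le> \<rho>"
    using compact_imp_bounded[OF K(1)] by (auto simp: bounded_iff)
  have "- K \<in> null_sets \<mu>"
    using K by (auto simp: null_sets_def compact_imp_closed)
  then have "AE t in \<mu>. t \<notin> - K" by (rule AE_not_in)
  then have "AE t in \<mu>. \<bar>t\<bar> \<le> \<rho>" by eventually_elim (use \<rho> in auto)
  then show thesis by (rule that)
qed

lemma is_spectral_measure_unique:
  assumes "is_spectral_measure \<tau> y \<mu>" "is_spectral_measure \<tau> y \<nu>"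
  shows "\<mu> = \<nu>"
proof -
  obtain \<rho>1 where 1: "AE t in \<mu>. \<bar>t\<bar> \<le> \<rho>1"
    using is_spectral_measure_bounded[OF assms(1)] .
  obtain \<rho>2 where 2: "AE t in \<nu>. \<bar>t\<bar> \<le> \<rho>2"
    using is_spectral_measure_bounded[OF assms(2)] .
  show ?thesis
  proof (rule moments_determine_distribution)
    show "real_distribution \<mu>" "real_distribution \<nu>"
      using assms by (auto simp: is_spectral_measure_def)
    show "AE t in \<mu>. \<bar>t\<bar> \<le> max \<rho>1 \<rho>2" using 1 by eventually_elim simp
    show "AE t in \<nu>. \<bar>t\<bar> \<le> max \<rho>1 \<rho>2" using 2 by eventually_elim simp
    show "(LINT t|\<mu>. t ^ k) = (LINT t|\<nu>. t ^ k)" for k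
      using assms unfolding is_spectral_measure_def by (metis of_real_eq_iff)
  qed
qed

section \<open>Finiteness of the free entropy\<close>

theorem mainTheorem3:
  fixes M :: "('h::complex_hilbert_space \<Rightarrow>\<^sub>L 'h) set"
    and \<tau> :: "('h \<Rightarrow>\<^sub>L 'h) \<Rightarrow> complex"
    and y :: "'h \<Rightarrow>\<^sub>L 'h"
  assumes "tracial_von_neumann_algebra M \<tau>"
    and "y \<in> M"
    and "self_adjoint y"
    and "algebraic_element \<tau> y"
    and "\<And>t. measure (spectral_measure \<tau> y) {t} = 0"
  shows "free_entropy \<tau> y > - \<infinity>"
proof -
  interpret tracial_von_neumann_algebra M \<tau> by fact
  define \<mu> where "\<mu> = spectral_measure \<tau> y"
  have "\<exists>!\<mu>. is_spectral_measure \<tau> y \<mu>"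
    using spectral_measure_exists[OF assms(2,3)] is_spectral_measure_unique by blast
  then have \<mu>: "is_spectral_measure \<tau> y \<mu>"
    unfolding \<mu>_def spectral_measure_def by (rule theI')
  interpret \<mu>: real_distribution \<mu> using \<mu> by (simp add: is_spectral_measure_def)
  obtain \<rho> where supp: "AE t in \<mu>. \<bar>t\<bar> \<le> \<rho>"
    using is_spectral_measure_bounded[OF \<mu>] .
  obtain Q :: "complex poly poly" where Q: "Q \<noteq> 0"
    "\<And>z. Im z > 0 \<Longrightarrow> poly (poly Q [:cauchy_transform \<mu> z:]) z = 0"
    using assms(4) unfolding algebraic_element_def \<mu>_def by blast
  obtain C \<delta> where "C \<ge> 0" "\<delta> > 0" and holder:
    "\<And>x \<epsilon>. \<bar>x\<bar> \<le> \<rho> \<Longrightarrow> 0 < \<epsilon> \<Longrightarrow> \<epsilon> \<le> 1 \<Longrightarrow> \<mu>.prob {x - \<epsilon>..x + \<epsilon>} \<le> C * \<epsilon> powr \<delta>"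
    using \<mu>.holder_uniform[OF Q, of \<rho>] assms(5) unfolding \<mu>_def by blast
  have "(\<integral>\<^sup>+ (s, t). e2ennreal (- log_abs (s - t)) \<partial>(\<mu> \<Otimes>\<^sub>M \<mu>)) < \<infinity>"
    by (rule \<mu>.log_energy_finite[OF supp \<open>C \<ge> 0\<close> \<open>\<delta> > 0\<close> holder])
  then have neg: "(\<integral>\<^sup>+ x. e2ennreal (- (case x of (s, t) \<Rightarrow> log_abs (s - t))) \<partial>(\<mu> \<Otimes>\<^sub>M \<mu>)) < \<infinity>"
    by (simp add: case_prod_unfold)
  \<comment> \<open>An infinite positive part only makes the difference \<open>\<infinity>\<close>, so the negative part decides.\<close>
  have "- \<infinity> < enn2ereal a - enn2ereal b" if "b < \<infinity>" for a b :: ennreal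
    using that by (cases a; cases b) (auto simp: enn2ereal_ennreal)
  from this[OF neg] show ?thesis
    unfolding free_entropy_def ereal_integral_def \<mu>_def[symmetric] by auto
qed

end
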